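(* Let $a<b$ be real numbers and let $f:[a,b]\to\mathbb{R}$ be a regulated function. For any $c>0$, the mappings $\mathbb{R}\ni y\mapsto u_c^y(f,[a,b])$ and $\mathbb{R}\ni y\mapsto d_c^y(f,[a,b])$ are pointwise limits of step functions, and the following equalities hold: $$\mathrm{UTV}^c(f,[a,b])=\int_{\mathbb{R}}u_c^y(f,[a,b])\,\mathrm{d}y,$$ $$\mathrm{DTV}^c(f,[a,b])=\int_{\mathbb{R}}d_c^y(f,[a,b])\,\mathrm{d}y,$$ $$\mathrm{TV}^c(f,[a,b])=\int_{\mathbb{R}}n_c^y(f,[a,b])\,\mathrm{d}y.$$
   Context: A function $f:[a,b]\to\mathbb{R}$ is regulated if it admits a right limit $f(t+)$ at every $t\in[a,b)$ and a left limit $f(t-)$ at every $t\in(a,b]$. A step function is a function that is constant on each piece of some finite partition of its domain into points and open intervals (possibly unbounded when the domain is $\mathbb{R}$). Integrals are Lebesgue integrals. Truncated variations. For $c>0$: $$\mathrm{TV}^c(f,[a,b]):=\sup_n\sup_{a\le t_0<t_1<\dots<t_n\le b}\sum_{i=1}^n\max\{|f(t_i)-f(t_{i-1})|-c,0\},$$ $$\mathrm{UTV}^c(f,[a,b]):=\sup_n\sup_{a\le t_0<t_1<\dots<t_n\le b}\sum_{i=1}^n\max\{f(t_i)-f(t_{i-1})-c,0\},$$ $$\mathrm{DTV}^c(f,[a,b]):=\sup_n\sup_{a\le t_0<t_1<\dots<t_n\le b}\sum_{i=1}^n\max\{f(t_{i-1})-f(t_i)-c,0\}.$$ Segment crossings.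 Fix $y\in\mathbb{R}$ and $c\ge 0$, and use the convention $\inf\emptyset=+\infty$. Downcrossings: put $\sigma_0^c=a$ and, for $n=0,1,\dots$, $$\tau_n^c=\inf\{t>\sigma_n^c: t\le b,\ f(t)>y+c\},\qquad \sigma_{n+1}^c=\inf\{t>\tau_n^c: t\le b,\ f(t)<y\}.$$ The number of downcrossings of $f$ from above the level $y+c$ to the level $y$ (downcrossings by $f$ of the closed segment $[y,y+c]$) on $[a,b]$ is $d_c^y(f,[a,b]):=\max\{n:\sigma_n^c\le b\}$. Upcrossings: put $\tilde\sigma_0^c=a$ and, for $n=0,1,\dots$, $$\tilde\tau_n^c=\inf\{t>\tilde\sigma_n^c: t\le b,\ f(t)<y\},\qquad \tilde\sigma_{n+1}^c=\inf\{t>\tilde\tau_n^c: t\le b,\ f(t)>y+c\}.$$ The number of upcrossings of $f$ from below the level $y$ to the level $y+c$ (upcrossings by $f$ of the closed segment $[y,y+c]$) on $[a,b]$ is $u_c^y(f,[a,b]):=\max\{n:\tilde\sigma_n^c\le b\}$. The number of crossings by $f$ of the segment $[y,y+c]$ (from above or from below) on $[a,b]$ is $n_c^y(f,[a,b]):=d_c^y(f,[a,b])+u_c^y(f,[a,b])$. For regulated $f$ and $c>0$ these numbers are finite.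
   Formalization: The first infimum in the up- and downcrossing counts runs over all t in [a,b], including t=a, rather than t>a; as literally defined the equalities fail, e.g. for f=1_{0} on [0,1], c=1/2. For f right-continuous at a the counts coincide. *)

theory Defs
  imports "HOL-Analysis.Analysis"
begin

definition regulated_on :: "real \<Rightarrow> real \<Rightarrow> (real \<Rightarrow> real) \<Rightarrow> bool" where
  "regulated_on a b f \<longleftrightarrow>
     (\<forall>t\<in>{a..<b}. \<exists>l. (f \<longlongrightarrow> l) (at_right t)) \<and>
     (\<forall>t\<in>{a<..b}. \<exists>l. (f \<longlongrightarrow> l) (at_left t))"

definition step_function_on :: "real set \<Rightarrow> (real \<Rightarrow> real) \<Rightarrow> bool" where
  "step_function_on D g \<longleftrightarrow>
     (\<exists>P. finite P \<and> partition_on D P \<and>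
          (\<forall>A\<in>P. ((\<exists>x. A = {x}) \<or> (open A \<and> is_interval A)) \<and> g constant_on A))"

definition pointwise_limit_of_step_functions :: "(real \<Rightarrow> real) \<Rightarrow> bool" where
  "pointwise_limit_of_step_functions h \<longleftrightarrow>
     (\<exists>g :: nat \<Rightarrow> real \<Rightarrow> real.
        (\<forall>k. step_function_on UNIV (g k)) \<and> (\<forall>y. (\<lambda>k. g k y) \<longlonglongrightarrow> h y))"


definition subdivisions :: "real \<Rightarrow> real \<Rightarrow> (nat \<times> (nat \<Rightarrow> real)) set" where
  "subdivisions a b = {(n, t). a \<le> t 0 \<and> (\<forall>i<n. t i < t (Suc i)) \<and> t n \<le> b}"

definition TV :: "real \<Rightarrow> (real \<Rightarrow> real) \<Rightarrow> real \<Rightarrow> real \<Rightarrow> ennreal" where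
  "TV c f a b = (SUP (n, t)\<in>subdivisions a b.
     ennreal (\<Sum>i=1..n. max (\<bar>f (t i) - f (t (i - 1))\<bar> - c) 0))"

definition UTV :: "real \<Rightarrow> (real \<Rightarrow> real) \<Rightarrow> real \<Rightarrow> real \<Rightarrow> ennreal" where
  "UTV c f a b = (SUP (n, t)\<in>subdivisions a b.
     ennreal (\<Sum>i=1..n. max (f (t i) - f (t (i - 1)) - c) 0))"

definition DTV :: "real \<Rightarrow> (real \<Rightarrow> real) \<Rightarrow> real \<Rightarrow> real \<Rightarrow> ennreal" where
  "DTV c f a b = (SUP (n, t)\<in>subdivisions a b.
     ennreal (\<Sum>i=1..n. max (f (t (i - 1)) - f (t i) - c) 0))"


text \<open>
  Times live in \<^typ>\<open>ereal\<close>, where \<^prop>\<open>Inf ({} :: ereal set) = \<infinity>\<close>.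
\<close>

definition hit_after :: "real \<Rightarrow> real \<Rightarrow> (real \<Rightarrow> bool) \<Rightarrow> ereal \<Rightarrow> ereal" where
  "hit_after a b P s = Inf (ereal ` {t \<in> {a..b}. s < ereal t \<and> P t})"

text \<open>
  Below, \<open>start\<close> is the time \<open>\<sigma>\<^sub>0\<close>. The inner \<^const>\<open>hit_after\<close> is \<open>\<tau>\<^sub>n\<close>, the whole right-hand
  side \<open>\<sigma>\<^sub>n\<^sub>+\<^sub>1\<close>.
\<close>

primrec down_time ::
  "ereal \<Rightarrow> real \<Rightarrow> (real \<Rightarrow> real) \<Rightarrow> real \<Rightarrow> real \<Rightarrow> real \<Rightarrow> nat \<Rightarrow> ereal" where
  "down_time start c f a b y 0 = start"
| "down_time start c f a b y (Suc n) =
     hit_after a b (\<lambda>t. f t < y)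
       (hit_after a b (\<lambda>t. f t > y + c) (down_time start c f a b y n))"

primrec up_time ::
  "ereal \<Rightarrow> real \<Rightarrow> (real \<Rightarrow> real) \<Rightarrow> real \<Rightarrow> real \<Rightarrow> real \<Rightarrow> nat \<Rightarrow> ereal" where
  "up_time start c f a b y 0 = start"
| "up_time start c f a b y (Suc n) =
     hit_after a b (\<lambda>t. f t > y + c)
       (hit_after a b (\<lambda>t. f t < y) (up_time start c f a b y n))"

definition downcrossings_from ::
  "ereal \<Rightarrow> real \<Rightarrow> (real \<Rightarrow> real) \<Rightarrow> real \<Rightarrow> real \<Rightarrow> real \<Rightarrow> nat" where
  "downcrossings_from start c f a b y = Max {n. down_time start c f a b y n \<le> ereal b}"

definition upcrossings_from ::
  "ereal \<Rightarrow> real \<Rightarrow> (real \<Rightarrow> real) \<Rightarrow> real \<Rightarrow> real \<Rightarrow> real \<Rightarrow> nat" where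
  "upcrossings_from start c f a b y = Max {n. up_time start c f a b y n \<le> ereal b}"

text \<open>
  With \<open>\<sigma>\<^sub>0 = a\<close> and the strict inequality \<open>t > \<sigma>\<^sub>0\<close>, the value \<open>f(a)\<close> would never be looked at, whereas
  the truncated variations do see it; the integral formulas then fail for functions which are
  not right-continuous at \<open>a\<close> (lemma \<open>start_at_left_end_point_fails\<close> below). We start at \<open>-\<infinity>\<close> instead,
  so that the first infimum runs over all of \<open>[a,b]\<close>. For functions which are right-continuous at
  \<open>a\<close> this makes no difference (lemmas \<open>downcrossings_from_left_end_point\<close> and
  \<open>upcrossings_from_left_end_point\<close>).
\<close>

definition downcrossings ::
  "real \<Rightarrow> (real \<Rightarrow> real) \<Rightarrow> real \<Rightarrow> real \<Rightarrow> real \<Rightarrow> nat" where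
  "downcrossings c f a b y = downcrossings_from (-\<infinity>) c f a b y"

definition upcrossings ::
  "real \<Rightarrow> (real \<Rightarrow> real) \<Rightarrow> real \<Rightarrow> real \<Rightarrow> real \<Rightarrow> nat" where
  "upcrossings c f a b y = upcrossings_from (-\<infinity>) c f a b y"

definition crossings ::
  "real \<Rightarrow> (real \<Rightarrow> real) \<Rightarrow> real \<Rightarrow> real \<Rightarrow> real \<Rightarrow> nat" where
  "crossings c f a b y = downcrossings c f a b y + upcrossings c f a b y"


lemma hit_after_eq_PInf:
  assumes "\<And>t. t \<in> {a..b} \<Longrightarrow> s < ereal t \<Longrightarrow> \<not> P t"
  shows "hit_after a b P s = \<infinity>"
proof -
  have "{t \<in> {a..b}. s < ereal t \<and> P t} = {}"
    using assms by blast
  then show ?thesis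
    unfolding hit_after_def by (simp only: image_empty Inf_empty top_ereal_def)
qed

lemma hit_after_left_end_point:
  assumes ab: "a < b" and ev: "P a \<Longrightarrow> eventually P (at_right a)"
  shows "hit_after a b P (ereal a) = hit_after a b P (-\<infinity>)"
proof (cases "P a")
  case False
  then have "{t \<in> {a..b}. ereal a < ereal t \<and> P t} = {t \<in> {a..b}. -\<infinity> < ereal t \<and> P t}"
    by (auto simp: order.order_iff_strict)
  then show ?thesis
    by (simp add: hit_after_def)
next
  case True
  then obtain d where d: "d > a" "\<And>t. a < t \<Longrightarrow> t < d \<Longrightarrow> P t"
    using ev by (auto simp: eventually_at_right_field)
  have "hit_after a b P (ereal a) = ereal a"
  proof (rule antisym)
    show "hit_after a b P (ereal a) \<le> ereal a"
    proof (rule ereal_le_epsilon2)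
      fix e :: real assume e: "0 < e"
      define t where "t = min (a + e) (min b ((a + d) / 2))"
      have t: "a < t" "t < d" "t \<le> b" "t \<le> a + e"
        using d(1) e ab by (auto simp: t_def min_def field_simps)
      have "hit_after a b P (ereal a) \<le> ereal t"
        unfolding hit_after_def using t d(2) by (intro Inf_lower) auto
      then show "hit_after a b P (ereal a) \<le> ereal a + ereal e"
        using t(4) by (metis ereal_less_eq(3) order_trans plus_ereal.simps(1))
    qed
  qed (auto simp: hit_after_def intro!: Inf_greatest)
  moreover have "hit_after a b P (-\<infinity>) = ereal a"
    unfolding hit_after_def
    using True ab by (intro antisym Inf_lower Inf_greatest) auto
  ultimately show ?thesis by simp
qed

lemma downcrossings_from_left_end_point:
  assumes "a < b" and cont: "(f \<longlongrightarrow> f a) (at_right a)"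
  shows "downcrossings_from (ereal a) c f a b y = downcrossings c f a b y"
proof -
  have "down_time (ereal a) c f a b y n \<le> ereal b \<longleftrightarrow> down_time (-\<infinity>) c f a b y n \<le> ereal b" for n
  proof (cases n)
    case 0
    then show ?thesis using \<open>a < b\<close> by simp
  next
    case (Suc m)
    have "down_time (ereal a) c f a b y (Suc m) = down_time (-\<infinity>) c f a b y (Suc m)"
    proof (induction m)
      case 0
      show ?case
        using hit_after_left_end_point[OF \<open>a < b\<close>, of "\<lambda>t. f t > y + c"] order_tendstoD(1)[OF cont]
        by simp
    qed (metis down_time.simps(2))
    then show ?thesis using Suc by simp
  qed
  then show ?thesis
    by (simp add: downcrossings_def downcrossings_from_def)
qed

lemma upcrossings_from_left_end_point:
  assumes "a < b" and cont: "(f \<longlongrightarrow> f a) (at_right a)"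
  shows "upcrossings_from (ereal a) c f a b y = upcrossings c f a b y"
proof -
  have "up_time (ereal a) c f a b y n \<le> ereal b \<longleftrightarrow> up_time (-\<infinity>) c f a b y n \<le> ereal b" for n
  proof (cases n)
    case 0
    then show ?thesis using \<open>a < b\<close> by simp
  next
    case (Suc m)
    have "up_time (ereal a) c f a b y (Suc m) = up_time (-\<infinity>) c f a b y (Suc m)"
    proof (induction m)
      case 0
      show ?case
        using hit_after_left_end_point[OF \<open>a < b\<close>, of "\<lambda>t. f t < y"] order_tendstoD(2)[OF cont]
        by simp
    qed (metis up_time.simps(2))
    then show ?thesis using Suc by simp
  qed
  then show ?thesis
    by (simp add: upcrossings_def upcrossings_from_def)
qed

lemma start_at_left_end_point_fails:
  fixes f :: "real \<Rightarrow> real"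
  defines "f \<equiv> indicator {0}"
  shows "regulated_on 0 1 f"
    and "DTV (1/2) f 0 1 \<noteq>
         (\<integral>\<^sup>+ y. ennreal (real (downcrossings_from (ereal 0) (1/2) f 0 1 y)) \<partial>lborel)"
proof -
  have "(f \<longlongrightarrow> 0) (at_right t)" if "0 \<le> t" for t
    by (rule tendsto_eventually)
      (use that in \<open>auto simp: f_def eventually_at_filter indicator_def\<close>)
  moreover have "(f \<longlongrightarrow> 0) (at_left t)" if "0 < t" for t
    by (rule tendsto_eventually)
      (use that in \<open>auto simp: f_def eventually_at_left indicator_def intro!: exI[of _ 0]\<close>)
  ultimately show "regulated_on 0 1 f"
    unfolding regulated_on_def by (intro conjI ballI exI[of _ 0]) auto
  have hit: "hit_after 0 1 (\<lambda>t. f t < y) (hit_after 0 1 (\<lambda>t. f t > y + 1/2) s) = \<infinity>"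
    if "s \<ge> ereal 0" for s y
  proof (cases "y \<le> 0")
    case True
    then show ?thesis
      by (intro hit_after_eq_PInf) (auto simp: f_def indicator_def)
  next
    case False
    have "hit_after 0 1 (\<lambda>t. f t > y + 1/2) s = \<infinity>"
      using that False
      by (intro hit_after_eq_PInf) (auto simp: f_def indicator_def zero_ereal_def split: if_splits)
    then show ?thesis
      by (simp only:) (rule hit_after_eq_PInf, simp)
  qed
  have inf: "down_time (ereal 0) (1/2) f 0 1 y (Suc n) = \<infinity>" for y n
  proof (induction n)
    case 0
    show ?case using hit[of "ereal 0" y] by simp
  next
    case (Suc n)
    have "hit_after 0 1 (\<lambda>t. f t < y) (hit_after 0 1 (\<lambda>t. f t > y + 1/2) \<infinity>) = \<infinity>"
      by (rule hit) simp
    then show ?case using Suc by (metis down_time.simps(2))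
  qed
  have "{n. down_time (ereal 0) (1/2) f 0 1 y n \<le> ereal 1} = {0}" for y
  proof -
    have "down_time (ereal 0) (1/2) f 0 1 y n \<le> ereal 1 \<longleftrightarrow> n = 0" for n
    proof (cases n)
      case (Suc m)
      then show ?thesis using inf[of y m] by (simp del: down_time.simps)
    qed simp
    then show ?thesis by auto
  qed
  then have "downcrossings_from (ereal 0) (1/2) f 0 1 y = 0" for y
    by (simp add: downcrossings_from_def)
  then have int: "(\<integral>\<^sup>+ y. ennreal (real (downcrossings_from (ereal 0) (1/2) f 0 1 y)) \<partial>lborel) = 0"
    by simp
  have "ennreal (\<Sum>i=1..1. max (f (real (i - 1)) - f (real i) - 1/2) 0) \<le> DTV (1/2) f 0 1"
    unfolding DTV_def by (rule SUP_upper2[of "(1, real)"]) (auto simp: subdivisions_def)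
  then have "ennreal (1/2) \<le> DTV (1/2) f 0 1"
    by (simp add: f_def)
  then have "DTV (1/2) f 0 1 \<noteq> 0"
    by (metis ennreal_eq_0_iff le_zero_eq not_le zero_less_divide_1_iff zero_less_numeral)
  then show "DTV (1/2) f 0 1 \<noteq>
      (\<integral>\<^sup>+ y. ennreal (real (downcrossings_from (ereal 0) (1/2) f 0 1 y)) \<partial>lborel)"
    using int by simp
qed

end

theory Submission
  imports Defs
begin

text \<open>
  Each term of a truncated variation is the length of an interval of levels: the step from \<open>f s\<close> to
  \<open>f t\<close> crosses the segment \<open>[y, y + c]\<close> upwards exactly for the levels \<open>y\<close> strictly between
  \<open>f s\<close> and \<open>f t - c\<close>.
  The crossings that single steps of a subdivision make at a level belong to one alternation of \<open>f\<close>
  between the conditions \<open>f < y\<close> and \<open>f > y + c\<close>, and the crossing numbers are the lengths of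
  longest alternations, because the hitting times in their definition choose greedily
  (\<open>le_upcrossings_iff\<close>, \<open>le_downcrossings_iff\<close>). Integration over the levels bounds each variation by
  the integral of the corresponding crossing number (\<open>step_sum_le_integral\<close>).

  For the converse, both the crossing numbers and the variations are reduced to finite lists of times.
  Alternations are stable under small perturbations of times and values, so that the counts along
  an increasing sequence of finite sets whose union is dense in the graph of \<open>f\<close>, increase to the crossing numbers
  (\<open>finite_counts_exhaust_crossings\<close>). They are step functions of the level, which gives the
  pointwise limits; monotone convergence gives the limits of the integrals.

  On a finite list the integral of the number of all crossings is attained by the truncated variation
  along a suitable sublist (\<open>crossing_integral_attained\<close>). The proof is dynamic programming from the
  right: which of the two conditions the remaining list meets first depends on the level through two
  thresholds, and both the integral and the optimal variation follow the same recursion in terms of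
  these two thresholds. The separate formulas for upward and downward variation come for
  free: the truncated variation of the sublist splits into its upward and downward parts, each of which
  is at most the integral of its crossing number, while the sums agree.

  The crossing numbers of a regulated function are finite (\<open>alternation_bounded\<close>), because finitely many
  points separate all pairs of times between which \<open>f\<close> changes by more than \<open>c\<close>.
\<close>

section \<open>Alternations between two conditions\<close>

text \<open>
  The longest chain of increasing times in \<open>S\<close> that satisfy \<open>P\<close>, \<open>Q\<close>, \<open>P\<close>, \<dots> in turn determines
  a crossing number. The times are chosen one by one from the left, all of them after \<open>s\<close>, so that
  this recursion has the shape of the successive hitting times.
\<close>
primrec alternation ::
  "nat \<Rightarrow> real set \<Rightarrow> (real \<Rightarrow> bool) \<Rightarrow> (real \<Rightarrow> bool) \<Rightarrow> ereal \<Rightarrow> bool"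
where
  "alternation 0 S P Q s \<longleftrightarrow> True"
| "alternation (Suc n) S P Q s \<longleftrightarrow> (\<exists>t\<in>S. s < ereal t \<and> P t \<and> alternation n S Q P (ereal t))"

text \<open>
  The two conditions swap roles at each match. Taking every match as soon as it comes makes this
  the length of the longest alternation along the list (lemma \<open>le_alternation_count_iff\<close>). The
  recursion from the front means that the count for \<open>P, Q\<close> of a longer list is determined by the two
  counts, for \<open>P, Q\<close> and for \<open>Q, P\<close>, of its tail.
\<close>
fun alternation_count :: "('a \<Rightarrow> bool) \<Rightarrow> ('a \<Rightarrow> bool) \<Rightarrow> 'a list \<Rightarrow> nat" where
  "alternation_count P Q [] = 0"
| "alternation_count P Q (t # ts) =
     (if P t then Suc (alternation_count Q P ts) else alternation_count P Q ts)"

lemma alternation_antimono: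
  "alternation n S P Q s \<Longrightarrow> s' \<le> s \<Longrightarrow> alternation n S P Q s'"
  by (cases n) (auto dest: le_less_trans)

lemma alternation_mono:
  "alternation n S P Q s \<Longrightarrow> S \<subseteq> S' \<Longrightarrow> alternation n S' P Q s"
  by (induction n arbitrary: P Q s) auto

lemma alternation_le:
  "alternation n S P Q s \<Longrightarrow> m \<le> n \<Longrightarrow> alternation m S P Q s"
proof (induction n arbitrary: m P Q s)
  case (Suc n)
  then show ?case by (cases m) auto
qed auto

lemma alternation_insert_past:
  assumes "ereal t \<le> s"
  shows "alternation n (insert t S) P Q s \<longleftrightarrow> alternation n S P Q s"
  using assms
proof (induction n arbitrary: P Q s)
  case (Suc n)
  have "alternation n (insert t S) Q P (ereal r) \<longleftrightarrow> alternation n S Q P (ereal r)"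
    if "s < ereal r" for r
    using Suc that by (meson less_imp_le order_trans)
  then show ?case using Suc.prems by auto
qed auto

text \<open>
  The greedy choice is optimal: the first time of any alternation can be moved back to the first
  element of the list that satisfies \<open>P\<close>, because an alternation after a time is also an alternation
  after every earlier time.
\<close>
lemma le_alternation_count_iff:
  assumes "sorted_wrt (<) ts" "\<And>t. t \<in> set ts \<Longrightarrow> s < ereal t"
  shows "n \<le> alternation_count P Q ts \<longleftrightarrow> alternation n (set ts) P Q s"
  using assms
proof (induction ts arbitrary: n P Q s)
  case Nil
  then show ?case by (cases n) auto
next
  case (Cons t ts)
  have IH: "m \<le> alternation_count P' Q' ts \<longleftrightarrow> alternation m (set ts) P' Q' (ereal t)" for m P' Q'
    using Cons.prems by (intro Cons.IH) auto
  have IHs: "m \<le> alternation_count P' Q' ts \<longleftrightarrow> alternation m (set ts) P' Q' s" for m P' Q'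
    using Cons.prems by (intro Cons.IH) auto
  have later: "t < r" if "r \<in> set ts" for r using Cons.prems that by auto
  show ?case
  proof (cases n)
    case 0
    then show ?thesis by simp
  next
    case (Suc m)
    have st: "s < ereal t" using Cons.prems by simp
    have past: "alternation m (insert t (set ts)) Q P (ereal r) \<longleftrightarrow> alternation m (set ts) Q P (ereal r)"
      if "t \<le> r" for r
      using that by (intro alternation_insert_past) auto
    show ?thesis
    proof (cases "P t")
      case True
      have "alternation n (set (t # ts)) P Q s \<longleftrightarrow> alternation m (set ts) Q P (ereal t)"
      proof
        assume "alternation n (set (t # ts)) P Q s"
        then obtain r where r: "r \<in> set (t # ts)" "alternation m (set (t # ts)) Q P (ereal r)"
          using Suc by auto
        then have "t \<le> r" using later by fastforce
        then show "alternation m (set ts) Q P (ereal t)"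
          using r(2) past[of r] alternation_antimono by auto
      next
        assume "alternation m (set ts) Q P (ereal t)"
        then show "alternation n (set (t # ts)) P Q s"
          using Suc True st past[of t] by auto
      qed
      then show ?thesis using IH True Suc by simp
    next
      case False
      have "alternation n (set (t # ts)) P Q s \<longleftrightarrow> alternation n (set ts) P Q s"
        using Suc False past later by (auto dest: less_imp_le)
      then show ?thesis using IHs False by simp
    qed
  qed
qed

section \<open>Crossing times and alternations\<close>

lemma hit_after_less_iff:
  "hit_after a b P s < x \<longleftrightarrow> (\<exists>t\<in>{a..b}. s < ereal t \<and> P t \<and> ereal t < x)"
  unfolding hit_after_def Inf_less_iff by auto

lemma hit_after_le_end_iff:
  "hit_after a b P s \<le> ereal b \<longleftrightarrow> (\<exists>t\<in>{a..b}. s < ereal t \<and> P t)"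
proof
  assume "hit_after a b P s \<le> ereal b"
  then have "hit_after a b P s < \<infinity>" by (rule le_less_trans) simp
  then show "\<exists>t\<in>{a..b}. s < ereal t \<and> P t" unfolding hit_after_less_iff by blast
next
  assume "\<exists>t\<in>{a..b}. s < ereal t \<and> P t"
  then obtain t where "t \<in> {a..b}" "s < ereal t" "P t" by blast
  then have "hit_after a b P s \<le> ereal t" unfolding hit_after_def by (intro Inf_lower) auto
  also have "\<dots> \<le> ereal b" using \<open>t \<in> {a..b}\<close> by simp
  finally show "hit_after a b P s \<le> ereal b" .
qed

text \<open>
  An infimum need not be attained, so the hitting time itself may fail to be a possible first
  element of an alternation. But the second element \<open>r\<close> lies strictly after the infimum, and
  hence there is a time satisfying \<open>P\<close> strictly before \<open>r\<close>, which serves as the first element.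
\<close>
lemma alternation_hit_after:
  "alternation (Suc (Suc n)) {a..b} P Q s \<longleftrightarrow> alternation (Suc n) {a..b} Q P (hit_after a b P s)"
proof
  assume "alternation (Suc (Suc n)) {a..b} P Q s"
  then obtain t where t: "t \<in> {a..b}" "s < ereal t" "P t" "alternation (Suc n) {a..b} Q P (ereal t)"
    by (metis alternation.simps(2))
  have "hit_after a b P s \<le> ereal t"
    unfolding hit_after_def using t by (intro Inf_lower) auto
  then show "alternation (Suc n) {a..b} Q P (hit_after a b P s)"
    using t(4) alternation_antimono by blast
next
  assume "alternation (Suc n) {a..b} Q P (hit_after a b P s)"
  then obtain r where r: "r \<in> {a..b}" "hit_after a b P s < ereal r" "Q r"
    "alternation n {a..b} P Q (ereal r)"
    by auto
  from r(2) obtain t where t: "t \<in> {a..b}" "s < ereal t" "P t" "ereal t < ereal r"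
    unfolding hit_after_less_iff by auto
  have "alternation (Suc n) {a..b} Q P (ereal t)"
    unfolding alternation.simps(2) using r t by blast
  then show "alternation (Suc (Suc n)) {a..b} P Q s"
    unfolding alternation.simps(2)[of "Suc n"] using t by blast
qed

lemma alternation_funpow_hit_after:
  assumes "0 < n"
  shows "((\<lambda>s. hit_after a b Q (hit_after a b P s)) ^^ n) s \<le> ereal b
    \<longleftrightarrow> alternation (2 * n) {a..b} P Q s"
  using assms
proof (induction n arbitrary: s rule: nat_induct_non_zero)
  case 1
  have "alternation 2 {a..b} P Q s \<longleftrightarrow> alternation (Suc 0) {a..b} Q P (hit_after a b P s)"
    using alternation_hit_after[of 0] by (simp add: numeral_2_eq_2)
  then show ?case by (simp add: hit_after_le_end_iff)
next
  case (Suc n)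
  \<comment> \<open>A hitting time can be split off only if at least one more element follows, as \<open>2 * n > 0\<close> ensures.\<close>
  obtain k where k: "2 * n = Suc k" using Suc.hyps by (cases "2*n") auto
  have "alternation (2 * Suc n) {a..b} P Q s
     \<longleftrightarrow> alternation (2 * n) {a..b} P Q (hit_after a b Q (hit_after a b P s))"
    using alternation_hit_after[of "Suc k"] alternation_hit_after[of k] k by simp
  then show ?case using Suc.IH by (simp only: funpow_Suc_right o_apply)
qed

lemma down_time_le_iff:
  "down_time (-\<infinity>) c f a b y n \<le> ereal b
     \<longleftrightarrow> alternation (2 * n) {a..b} (\<lambda>t. f t > y + c) (\<lambda>t. f t < y) (-\<infinity>)"
proof -
  have "down_time s c f a b y n
      = ((\<lambda>s. hit_after a b (\<lambda>t. f t < y) (hit_after a b (\<lambda>t. f t > y + c) s)) ^^ n) s" for s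
    by (induction n) auto
  then show ?thesis using alternation_funpow_hit_after[of n] by (cases "n = 0") simp_all
qed

lemma up_time_le_iff:
  "up_time (-\<infinity>) c f a b y n \<le> ereal b
     \<longleftrightarrow> alternation (2 * n) {a..b} (\<lambda>t. f t < y) (\<lambda>t. f t > y + c) (-\<infinity>)"
proof -
  have "up_time s c f a b y n
      = ((\<lambda>s. hit_after a b (\<lambda>t. f t > y + c) (hit_after a b (\<lambda>t. f t < y) s)) ^^ n) s" for s
    by (induction n) auto
  then show ?thesis using alternation_funpow_hit_after[of n] by (cases "n = 0") simp_all
qed

section \<open>Finiteness of crossing numbers of regulated functions\<close>

text \<open>
  Near a point \<open>x\<close>, on either side of it, the one-sided limit makes \<open>f\<close> vary by at most \<open>c\<close>, so a
  variation above \<open>c\<close> over a short interval must involve \<open>x\<close> itself. Bisection of \<open>[a,b]\<close> turns this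
  local fact into finitely many separating points: gluing two intervals adds only their common end
  point.
\<close>
lemma regulated_finite_separator:
  assumes reg: "regulated_on a b f" and "a \<le> b" "c > 0"
  shows "\<exists>F. finite F \<and> (\<forall>s\<in>{a..b}. \<forall>t\<in>{a..b}. s < t \<longrightarrow> c < \<bar>f s - f t\<bar> \<longrightarrow> F \<inter> {s..t} \<noteq> {})"
proof -
  define G where "G u v \<longleftrightarrow> (\<exists>F. finite F \<and> (\<forall>s\<in>{a..b}\<inter>{u..v}. \<forall>t\<in>{a..b}\<inter>{u..v}. s < t \<longrightarrow> c < \<bar>f s - f t\<bar>
    \<longrightarrow> F \<inter> {s..t} \<noteq> {}))" for u v
  have "G a b"
    using \<open>a \<le> b\<close>
  proof (induction rule: Bolzano)
    case (trans u v w)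
    from trans(1) obtain F1 where F1: "finite F1" "\<And>s t. s\<in>{a..b}\<inter>{u..v} \<Longrightarrow> t\<in>{a..b}\<inter>{u..v} \<Longrightarrow> s < t
      \<Longrightarrow> c < \<bar>f s - f t\<bar> \<Longrightarrow> F1 \<inter> {s..t} \<noteq> {}"
      unfolding G_def by blast
    from trans(2) obtain F2 where F2: "finite F2" "\<And>s t. s\<in>{a..b}\<inter>{v..w} \<Longrightarrow> t\<in>{a..b}\<inter>{v..w} \<Longrightarrow> s < t
      \<Longrightarrow> c < \<bar>f s - f t\<bar> \<Longrightarrow> F2 \<inter> {s..t} \<noteq> {}"
      unfolding G_def by blast
    have "insert v (F1 \<union> F2) \<inter> {s..t} \<noteq> {}"
      if "s\<in>{a..b}\<inter>{u..w}" "t\<in>{a..b}\<inter>{u..w}" "s < t" "c < \<bar>f s - f t\<bar>" for s t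
    proof -
      consider "t \<le> v" | "v \<le> s" | "s \<le> v" "v \<le> t" by linarith
      then show ?thesis
        using F1(2)[of s t] F2(2)[of s t] that by cases auto
    qed
    then show ?case
      unfolding G_def using F1(1) F2(1) by (intro exI[of _ "insert v (F1 \<union> F2)"]) blast
  next
    case (local x)
    have right: "\<exists>d>0. \<forall>s t. s \<in> {x<..<x+d} \<inter> {a..b} \<longrightarrow> t \<in> {x<..<x+d} \<inter> {a..b} \<longrightarrow> \<bar>f s - f t\<bar> \<le> c"
    proof (cases "x = b")
      case True
      then show ?thesis by (intro exI[of _ 1]) auto
    next
      case False
      then obtain l where "(f \<longlongrightarrow> l) (at_right x)"
        using reg local unfolding regulated_on_def by fastforce
      then have "eventually (\<lambda>t. dist (f t) l < c / 2) (at_right x)"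
        using \<open>c > 0\<close> by (intro tendstoD) auto
      then obtain e where e: "e > x" "\<And>t. x < t \<Longrightarrow> t < e \<Longrightarrow> dist (f t) l < c / 2"
        by (auto simp: eventually_at_right_field)
      show ?thesis
      proof (intro exI[of _ "e - x"] conjI allI impI)
        fix s t assume "s \<in> {x<..<x+(e-x)} \<inter> {a..b}" "t \<in> {x<..<x+(e-x)} \<inter> {a..b}"
        then have "dist (f s) l < c/2" "dist (f t) l < c/2" using e(2) by auto
        then show "\<bar>f s - f t\<bar> \<le> c" unfolding dist_real_def by linarith
      qed (use e in auto)
    qed
    have left: "\<exists>d>0. \<forall>s t. s \<in> {x-d<..<x} \<inter> {a..b} \<longrightarrow> t \<in> {x-d<..<x} \<inter> {a..b} \<longrightarrow> \<bar>f s - f t\<bar> \<le> c"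
    proof (cases "x = a")
      case True
      then show ?thesis by (intro exI[of _ 1]) auto
    next
      case False
      then obtain l where "(f \<longlongrightarrow> l) (at_left x)"
        using reg local unfolding regulated_on_def by fastforce
      then have "eventually (\<lambda>t. dist (f t) l < c / 2) (at_left x)"
        using \<open>c > 0\<close> by (intro tendstoD) auto
      then obtain e where e: "e < x" "\<And>t. e < t \<Longrightarrow> t < x \<Longrightarrow> dist (f t) l < c / 2"
        by (auto simp: eventually_at_left_field)
      show ?thesis
      proof (intro exI[of _ "x - e"] conjI allI impI)
        fix s t assume "s \<in> {x-(x-e)<..<x} \<inter> {a..b}" "t \<in> {x-(x-e)<..<x} \<inter> {a..b}"
        then have "dist (f s) l < c/2" "dist (f t) l < c/2" using e(2) by auto
        then show "\<bar>f s - f t\<bar> \<le> c" unfolding dist_real_def by linarith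
      qed (use e in auto)
    qed
    from right obtain d1 where d1: "d1 > 0" "\<And>s t. s \<in> {x<..<x+d1} \<inter> {a..b} \<Longrightarrow> t \<in> {x<..<x+d1} \<inter> {a..b}
      \<Longrightarrow> \<bar>f s - f t\<bar> \<le> c" by blast
    from left obtain d2 where d2: "d2 > 0" "\<And>s t. s \<in> {x-d2<..<x} \<inter> {a..b} \<Longrightarrow> t \<in> {x-d2<..<x} \<inter> {a..b}
      \<Longrightarrow> \<bar>f s - f t\<bar> \<le> c" by blast
    have "G u v" if uv: "u \<le> x" "x \<le> v" "v - u < min d1 d2" for u v
      unfolding G_def
    proof (intro exI[of _ "{x}"] conjI ballI impI)
      fix s t assume s: "s\<in>{a..b}\<inter>{u..v}" and t: "t\<in>{a..b}\<inter>{u..v}" and "s < t" and big: "c < \<bar>f s - f t\<bar>"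
      show "{x} \<inter> {s..t} \<noteq> {}"
      proof (rule ccontr)
        assume "\<not> ?thesis"
        then consider "t < x" | "x < s" using \<open>s < t\<close> by force
        then show False
        proof cases
          case 1
          then show False using d2(2)[of s t] s t uv \<open>s < t\<close> big by auto
        next
          case 2
          then show False using d1(2)[of s t] s t uv \<open>s < t\<close> big by auto
        qed
      qed
    qed auto
    then show ?case using d1(1) d2(1) by (intro exI[of _ "min d1 d2"]) auto
  qed
  then show ?thesis unfolding G_def by simp
qed

text \<open>
  Between consecutive times of an alternation there is a separating point. A point may lie at
  the common end of two adjacent intervals and thus serve twice, but not more often; counting the
  points of \<open>F\<close> once in closed and once in open half-lines accounts for this, since each step of the
  alternation strictly decreases one of the two cardinalities.
\<close>
lemma alternation_le_separator:
  assumes "finite F" and "S \<subseteq> {a..b}"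
    and sep: "\<And>s t. s \<in> {a..b} \<Longrightarrow> t \<in> {a..b} \<Longrightarrow> s < t \<Longrightarrow> P s \<and> Q t \<or> Q s \<and> P t \<Longrightarrow> F \<inter> {s..t} \<noteq> {}"
    and "r \<in> {a..b}" "Q r" "alternation n S P Q (ereal r)"
  shows "n \<le> card (F \<inter> {r..}) + card (F \<inter> {r<..})"
  using assms(3-)
proof (induction n arbitrary: P Q r)
  case (Suc n)
  then obtain t where t: "t \<in> {a..b}" "r < t" "P t" "alternation n S Q P (ereal t)"
    using \<open>S \<subseteq> {a..b}\<close> by auto
  have IH: "n \<le> card (F \<inter> {t..}) + card (F \<inter> {t<..})"
    using Suc.prems t by (intro Suc.IH[of Q P]) blast+
  obtain p where p: "p \<in> F" "r \<le> p" "p \<le> t"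
    using Suc.prems(1)[of r t] Suc.prems(2,3) t(1-3) by auto
  have le: "card (F \<inter> {t..}) \<le> card (F \<inter> {r..})" "card (F \<inter> {t<..}) \<le> card (F \<inter> {r<..})"
    using \<open>finite F\<close> t(2) by (auto intro!: card_mono)
  show ?case
  proof (cases "p < t")
    case True
    then have "p \<in> F \<inter> {r..}" "p \<notin> F \<inter> {t..}" "F \<inter> {t..} \<subseteq> F \<inter> {r..}" using p t(2) by auto
    then have "F \<inter> {t..} \<subset> F \<inter> {r..}" by blast
    then have "card (F \<inter> {t..}) < card (F \<inter> {r..})" using \<open>finite F\<close> by (intro psubset_card_mono) auto
    then show ?thesis using IH le by linarith
  next
    case False
    then have "p \<in> F \<inter> {r<..}" "p \<notin> F \<inter> {t<..}" "F \<inter> {t<..} \<subseteq> F \<inter> {r<..}" using p t(2) by auto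
    then have "F \<inter> {t<..} \<subset> F \<inter> {r<..}" by blast
    then have "card (F \<inter> {t<..}) < card (F \<inter> {r<..})" using \<open>finite F\<close> by (intro psubset_card_mono) auto
    then show ?thesis using IH le by linarith
  qed
qed auto

lemma alternation_bounded:
  assumes "regulated_on a b f" "a \<le> b" "c > 0"
    and gap: "\<And>s t. P s \<Longrightarrow> Q t \<Longrightarrow> c < \<bar>f s - f t\<bar>"
  shows "\<exists>N. \<forall>n. alternation n {a..b} P Q s \<longrightarrow> n \<le> N"
proof -
  obtain F where F: "finite F" "\<And>s t. s\<in>{a..b} \<Longrightarrow> t\<in>{a..b} \<Longrightarrow> s < t \<Longrightarrow> c < \<bar>f s - f t\<bar> \<Longrightarrow> F \<inter> {s..t} \<noteq> {}"
    using regulated_finite_separator[OF assms(1-3)] by blast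
  have "n \<le> Suc (2 * card F)" if n: "alternation n {a..b} P Q s" for n
  proof (cases n)
    case (Suc m)
    then obtain t where t: "t \<in> {a..b}" "P t" "alternation m {a..b} Q P (ereal t)"
      using n by auto
    have "m \<le> card (F \<inter> {t..}) + card (F \<inter> {t<..})"
    proof (rule alternation_le_separator[OF F(1) order.refl _ t])
      fix s t assume "s \<in> {a..b}" "t \<in> {a..b}" "s < t" "Q s \<and> P t \<or> P s \<and> Q t"
      then show "F \<inter> {s..t} \<noteq> {}" using F(2)[of s t] gap[of s t] gap[of t s] abs_minus_commute[of
        "f s" "f t"] by metis
    qed
    also have "\<dots> \<le> card F + card F"
      using F(1) by (intro add_mono card_mono) auto
    finally show ?thesis using Suc by simp
  qed simp
  then show ?thesis by blast
qed

lemma le_Max_iff_downward: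
  fixes A :: "nat set"
  assumes "\<And>n. n \<in> A \<Longrightarrow> n \<le> N" "0 \<in> A" "\<And>m n. n \<in> A \<Longrightarrow> m \<le> n \<Longrightarrow> m \<in> A"
  shows "n \<le> Max A \<longleftrightarrow> n \<in> A"
proof -
  have "finite A" using assms(1) by (meson finite_nat_set_iff_bounded_le)
  then show ?thesis using assms Max_in[of A] Max_ge[of A n] by blast
qed

lemma le_upcrossings_iff:
  assumes "regulated_on a b f" "a \<le> b" "c > 0"
  shows "n \<le> upcrossings c f a b y
    \<longleftrightarrow> alternation (2 * n) {a..b} (\<lambda>t. f t < y) (\<lambda>t. f t > y + c) (-\<infinity>)"
proof -
  obtain N where "\<And>n. alternation n {a..b} (\<lambda>t. f t < y) (\<lambda>t. f t > y + c) (-\<infinity>) \<Longrightarrow> n \<le> N"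
    using alternation_bounded[OF assms, of "\<lambda>t. f t < y" "\<lambda>t. f t > y + c"] by force
  then show ?thesis
    unfolding upcrossings_def upcrossings_from_def up_time_le_iff
    by (subst le_Max_iff_downward[where N = N]) (force intro: alternation_le)+
qed

lemma le_downcrossings_iff:
  assumes "regulated_on a b f" "a \<le> b" "c > 0"
  shows "n \<le> downcrossings c f a b y
    \<longleftrightarrow> alternation (2 * n) {a..b} (\<lambda>t. f t > y + c) (\<lambda>t. f t < y) (-\<infinity>)"
proof -
  obtain N where "\<And>n. alternation n {a..b} (\<lambda>t. f t > y + c) (\<lambda>t. f t < y) (-\<infinity>) \<Longrightarrow> n \<le> N"
    using alternation_bounded[OF assms, of "\<lambda>t. f t > y + c" "\<lambda>t. f t < y"] by force
  then show ?thesis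
    unfolding downcrossings_def downcrossings_from_def down_time_le_iff
    by (subst le_Max_iff_downward[where N = N]) (force intro: alternation_le)+
qed

section \<open>Exhaustion of the interval by finite sets\<close>

text \<open>
  The graph of \<open>f\<close> is a separable metric space, being a subset of the plane. A countable dense
  subset of the graph approximates times together with the values there, also at the
  discontinuities of \<open>f\<close>.
\<close>
lemma finite_graph_exhaustion:
  fixes f :: "real \<Rightarrow> real"
  assumes "S \<noteq> {}"
  shows "\<exists>T :: nat \<Rightarrow> real set. incseq T \<and> (\<forall>k. finite (T k) \<and> T k \<subseteq> S) \<and>
    (\<forall>t\<in>S. \<forall>e>0. \<exists>k. \<exists>d\<in>T k. \<bar>d - t\<bar> < e \<and> \<bar>f d - f t\<bar> < e)"
proof -
  obtain D where D: "countable D" "D \<subseteq> (\<lambda>t. (t, f t)) ` S" "(\<lambda>t. (t, f t)) ` S \<subseteq> closure D"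
    using separable by metis
  have "D \<noteq> {}" using assms D(3) by auto
  define T where "T k = fst ` from_nat_into D ` {..<k}" for k
  have fin: "finite (T k)" for k by (simp add: T_def)
  have in_D: "from_nat_into D i \<in> D" for i using \<open>D \<noteq> {}\<close> by (rule from_nat_into)
  have sub: "T k \<subseteq> S" for k
  proof
    fix d assume "d \<in> T k"
    then obtain i where "d = fst (from_nat_into D i)" by (auto simp: T_def)
    then show "d \<in> S" using in_D[of i] D(2) by auto
  qed
  have inc: "incseq T" by (auto simp: T_def incseq_def)
  have dense: "\<exists>k. \<exists>d\<in>T k. \<bar>d - t\<bar> < e \<and> \<bar>f d - f t\<bar> < e" if t: "t \<in> S" and e: "0 < e" for t e
  proof -
    have "(t, f t) \<in> closure D" using D(3) t by auto
    then obtain p where p: "p \<in> D" "dist p (t, f t) < e"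
      using e by (meson closure_approachable)
    obtain d where d: "p = (d, f d)" using p(1) D(2) by auto
    obtain i where i: "p = from_nat_into D i"
      using p(1) D(1) by (metis from_nat_into_to_nat_on)
    have "fst p \<in> T (Suc i)" unfolding T_def i by blast
    moreover have "\<bar>d - t\<bar> < e" "\<bar>f d - f t\<bar> < e"
      using p(2) dist_fst_le[of p "(t, f t)"] dist_snd_le[of p "(t, f t)"]
      unfolding d by (auto simp: dist_real_def)
    ultimately show ?thesis unfolding d fst_conv by blast
  qed
  show ?thesis
    by (intro exI[of _ T] conjI allI ballI impI inc fin sub dense)
qed

text \<open>
  The conditions on the values are open, so each time of an alternation can be replaced by a
  nearby time of some \<open>T k\<close> with a nearby value. The replacement may be later than the
  original time but must precede the rest of the alternation; the induction ensures this by providing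
  a starting time strictly after \<open>s\<close>.
\<close>
lemma alternation_exhaustion:
  fixes f :: "real \<Rightarrow> real"
  assumes T: "incseq T" "\<And>t e. t \<in> S \<Longrightarrow> e > 0 \<Longrightarrow> \<exists>k. \<exists>d\<in>T k. \<bar>d - t\<bar> < e \<and> \<bar>f d - f t\<bar> < e"
    and "open U" "open V"
    and "alternation n S (\<lambda>t. f t \<in> U) (\<lambda>t. f t \<in> V) s" "s < \<infinity>"
  shows "\<exists>k. \<exists>s'>s. alternation n (T k) (\<lambda>t. f t \<in> U) (\<lambda>t. f t \<in> V) s'"
  using assms(3-)
proof (induction n arbitrary: U V s)
  case 0
  then show ?case by (auto intro: dense)
next
  case (Suc n)
  then obtain t where t: "t \<in> S" "s < ereal t" "f t \<in> U"
    "alternation n S (\<lambda>t. f t \<in> V) (\<lambda>t. f t \<in> U) (ereal t)"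
    by auto
  obtain k r where r: "ereal t < r" "alternation n (T k) (\<lambda>t. f t \<in> V) (\<lambda>t. f t \<in> U) r"
    using Suc.IH[OF Suc.prems(2,1) t(4)] by auto
  obtain p where p: "ereal t < ereal p" "ereal p < r" using ereal_dense2[OF r(1)] by auto
  obtain q where q: "s < ereal q" "ereal q < ereal t" using ereal_dense2[OF t(2)] by auto
  obtain e where e: "e > 0" "\<And>z. dist z (f t) < e \<Longrightarrow> z \<in> U"
    using \<open>open U\<close> t(3) unfolding open_dist by blast
  define e' where "e' = min e (min (p - t) (t - q))"
  have "e' > 0" using e p q by (simp add: e'_def)
  then obtain j d where d: "d \<in> T j" "\<bar>d - t\<bar> < e'" "\<bar>f d - f t\<bar> < e'"
    using T(2)[OF t(1)] by blast
  have fd: "f d \<in> U" using d(3) by (intro e(2)) (simp add: e'_def dist_real_def)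
  have "q < d" "d < p" using d(2) by (auto simp: e'_def)
  have "alternation n (T k) (\<lambda>t. f t \<in> V) (\<lambda>t. f t \<in> U) (ereal d)"
    using r(2) by (rule alternation_antimono) (use \<open>d < p\<close> p less_trans[of "ereal d"
      "ereal p" r] in auto)
  moreover have "T k \<subseteq> T (max j k)" "T j \<subseteq> T (max j k)" using T(1) by (auto simp: incseq_def)
  ultimately have "alternation (Suc n) (T (max j k)) (\<lambda>t. f t \<in> U) (\<lambda>t. f t \<in> V) (ereal q)"
    using d(1) fd \<open>q < d\<close> by (auto intro: alternation_mono)
  then show ?case using q(1) by blast
qed

section \<open>Counts along finite lists\<close>

text \<open>
  The two alternations have the same matches once the first one is made; they differ only in
  whether that first one is counted. Which of the two counts is larger shows which of \<open>P\<close> and \<open>Q\<close>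
  is met first.
\<close>
lemma alternation_count_swap:
  assumes "\<And>t. \<not> (P t \<and> Q t)"
  shows "alternation_count P Q ts = 0 \<and> alternation_count Q P ts = 0
     \<or> alternation_count P Q ts = Suc (alternation_count Q P ts)
     \<or> alternation_count Q P ts = Suc (alternation_count P Q ts)"
proof (induction ts)
  case (Cons t ts)
  then show ?case
    unfolding alternation_count.simps using assms[of t] by presburger
qed simp

lemma alternation_count_cong:
  assumes "\<And>t. t \<in> set ts \<Longrightarrow> P t \<longleftrightarrow> P' t" "\<And>t. t \<in> set ts \<Longrightarrow> Q t \<longleftrightarrow> Q' t"
  shows "alternation_count P Q ts = alternation_count P' Q' ts"
  using assms
proof (induction ts arbitrary: P P' Q Q')
  case (Cons t ts)
  have "alternation_count P Q ts = alternation_count P' Q' ts"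
    by (rule Cons.IH) (simp_all add: Cons.prems)
  moreover have "alternation_count Q P ts = alternation_count Q' P' ts"
    by (rule Cons.IH) (simp_all add: Cons.prems)
  ultimately show ?case using Cons.prems(1)[of t] by simp
qed simp

lemma measurable_alternation_count:
  assumes "\<And>t. Measurable.pred M (\<lambda>y. P y t)" "\<And>t. Measurable.pred M (\<lambda>y. Q y t)"
  shows "(\<lambda>y. alternation_count (P y) (Q y) ts) \<in> measurable M (count_space UNIV)"
  using assms
proof (induction ts arbitrary: P Q)
  case (Cons t ts)
  note [measurable] = Cons.prems Cons.IH[OF Cons.prems] Cons.IH[OF Cons.prems(2,1)]
  show ?case by simp
qed simp

text \<open>
  A crossing consists of two consecutive matches, whence the division by two.
\<close>
abbreviation up_count :: "real \<Rightarrow> ('a \<Rightarrow> real) \<Rightarrow> 'a list \<Rightarrow> real \<Rightarrow> nat" where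
  "up_count c f ts y \<equiv> alternation_count (\<lambda>t. f t < y) (\<lambda>t. f t > y + c) ts div 2"

abbreviation down_count :: "real \<Rightarrow> ('a \<Rightarrow> real) \<Rightarrow> 'a list \<Rightarrow> real \<Rightarrow> nat" where
  "down_count c f ts y \<equiv> alternation_count (\<lambda>t. f t > y + c) (\<lambda>t. f t < y) ts div 2"

lemma measurable_up_count: "(\<lambda>y. ennreal (real (up_count c f ts y))) \<in> borel_measurable lborel"
proof -
  have [measurable]:
    "(\<lambda>y. alternation_count (\<lambda>t. f t < y) (\<lambda>t. f t > y + c) ts) \<in> measurable borel (count_space UNIV)"
    by (rule measurable_alternation_count) measurable
  show ?thesis by measurable
qed

lemma measurable_down_count: "(\<lambda>y. ennreal (real (down_count c f ts y))) \<in> borel_measurable lborel"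
proof -
  have [measurable]:
    "(\<lambda>y. alternation_count (\<lambda>t. f t > y + c) (\<lambda>t. f t < y) ts) \<in> measurable borel (count_space UNIV)"
    by (rule measurable_alternation_count) measurable
  show ?thesis by measurable
qed

section \<open>The sum of truncated steps is at most the integral of the counts\<close>

fun step_sum :: "('a \<Rightarrow> 'a \<Rightarrow> real) \<Rightarrow> 'a list \<Rightarrow> real" where
  "step_sum g [] = 0"
| "step_sum g [s] = 0"
| "step_sum g (s # t # ts) = g s t + step_sum g (t # ts)"

lemma step_sum_nonneg: "(\<And>s t. 0 \<le> g s t) \<Longrightarrow> 0 \<le> step_sum g ts"
  by (induction g ts rule: step_sum.induct) auto

lemma step_sum_add: "step_sum (\<lambda>s t. g s t + h s t) ts = step_sum g ts + step_sum h ts"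
  by (induction g ts rule: step_sum.induct) auto

text \<open>
  A step from \<open>s\<close> to \<open>t\<close> contributes the measure of the set of levels \<open>y\<close> that it crosses by itself.
  At such a level, prepending \<open>s\<close> to a list starting with \<open>t\<close> gains one full crossing; at the
  other levels it loses none.
\<close>
lemma step_sum_le_integral:
  fixes P Q :: "real \<Rightarrow> 'a \<Rightarrow> bool"
  assumes [measurable]: "\<And>t. Measurable.pred borel (\<lambda>y. P y t)" "\<And>t. Measurable.pred borel (\<lambda>y. Q y t)"
    and disj: "\<And>y t. \<not> (P y t \<and> Q y t)"
    and g: "\<And>s t. ennreal (g s t) = emeasure lborel {y. P y s \<and> Q y t}" "\<And>s t. 0 \<le> g s t"
  shows "ennreal (step_sum g ts)
    \<le> (\<integral>\<^sup>+ y. ennreal (real (alternation_count (P y) (Q y) ts div 2)) \<partial>lborel)"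
  using g
proof (induction g ts rule: step_sum.induct)
  case (3 g s t ts)
  let ?A = "{y. P y s \<and> Q y t}"
  have [measurable]:
    "(\<lambda>y. alternation_count (P y) (Q y) ts) \<in> measurable borel (count_space UNIV)" for ts
    by (rule measurable_alternation_count) measurable
  have "ennreal (step_sum g (s # t # ts)) = ennreal (g s t) + ennreal (step_sum g (t # ts))"
    using 3 step_sum_nonneg[of g "t # ts"] by (simp add: ennreal_plus)
  also have "\<dots> \<le> emeasure lborel ?A
      + (\<integral>\<^sup>+ y. ennreal (real (alternation_count (P y) (Q y) (t # ts) div 2)) \<partial>lborel)"
    using 3 by (intro add_mono) auto
  also have
    "\<dots> = (\<integral>\<^sup>+ y. indicator ?A y + ennreal (real (alternation_count (P y) (Q y) (t # ts) div 2)) \<partial>lborel)"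
    by (subst nn_integral_add) (auto simp: nn_integral_indicator simp del: alternation_count.simps)
  also have "\<dots> \<le> (\<integral>\<^sup>+ y. ennreal (real (alternation_count (P y) (Q y) (s # t # ts) div 2)) \<partial>lborel)"
  proof (rule nn_integral_mono)
    fix y
    let ?n = "\<lambda>ts. alternation_count (P y) (Q y) ts div 2"
    have "of_bool (y \<in> ?A) + ?n (t # ts) \<le> ?n (s # t # ts)"
    proof (cases "y \<in> ?A")
      case True
      then show ?thesis using disj[of y s] disj[of y t] by simp
    next
      case False
      then show ?thesis
        using alternation_count_swap[of "P y" "Q y" "t # ts"] disj[of y]
        unfolding alternation_count.simps(2)[of _ _ s] by (simp del: alternation_count.simps) linarith
    qed
    then have "real (of_bool (y \<in> ?A) + ?n (t # ts)) \<le> real (?n (s # t # ts))"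
      by (simp only: of_nat_le_iff)
    then show "indicator ?A y + ennreal (real (?n (t # ts))) \<le> ennreal (real (?n (s # t # ts)))"
      by (auto simp: indicator_def simp flip: ennreal_plus ennreal_1 split: if_splits)
  qed
  finally show ?case .
qed auto

lemma emeasure_lborel_Ioo_max: "emeasure lborel {l<..<u :: real} = ennreal (max (u - l) 0)"
  by (cases "l \<le> u") (auto simp: max_def ennreal_neg)

lemma step_sum_le_integral_up:
  assumes "c > 0"
  shows "ennreal (step_sum (\<lambda>s t. max (f t - f s - c) 0) ts)
    \<le> (\<integral>\<^sup>+ y. ennreal (real (up_count c f ts y)) \<partial>lborel)"
proof (rule step_sum_le_integral)
  show "ennreal (max (f t - f s - c) 0) = emeasure lborel {y. f s < y \<and> f t > y + c}" for s t
  proof -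
    have "{y. f s < y \<and> f t > y + c} = {f s<..<f t - c}" by auto
    then show ?thesis using emeasure_lborel_Ioo_max[of "f s" "f t - c"] by (simp add: algebra_simps)
  qed
qed (use assms in auto)

lemma step_sum_le_integral_down:
  assumes "c > 0"
  shows "ennreal (step_sum (\<lambda>s t. max (f s - f t - c) 0) ts)
    \<le> (\<integral>\<^sup>+ y. ennreal (real (down_count c f ts y)) \<partial>lborel)"
proof (rule step_sum_le_integral)
  show "ennreal (max (f s - f t - c) 0) = emeasure lborel {y. f s > y + c \<and> f t < y}" for s t
  proof -
    have "{y. f s > y + c \<and> f t < y} = {f t<..<f s - c}" by auto
    then show ?thesis using emeasure_lborel_Ioo_max[of "f t" "f s - c"] by (simp add: algebra_simps)
  qed
qed (use assms in auto)

section \<open>The integral of the counts is attained along a sublist\<close>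

text \<open>
  The arithmetic of one induction step in \<open>crossing_integral_attained\<close>, where \<open>l\<close> and \<open>h\<close> are the
  thresholds of a list and \<open>N\<close> is its integral. Prepending a value \<open>w\<close> clamps them to \<open>[w - c, w]\<close>
    and adds the levels
  crossed on the way to the integral. The left-hand side is the integral after prepending first
  \<open>w\<close> and then \<open>v\<close>; the right-hand side is the better of skipping \<open>w\<close> and of stepping from \<open>v\<close> to \<open>w\<close>.
\<close>
lemma clamp_inequality:
  fixes h l v w N c :: real
  assumes "h \<le> l" "l \<le> h + c" "c > 0"
  shows "N + max (w - c - l) 0 + max (h - w) 0
      + max (v - c - min w (max l (w - c))) 0 + max (max (w - c) (min h w) - v) 0
    \<le> max (N + max (v - c - l) 0 + max (h - v) 0)
        (N + max (w - c - l) 0 + max (h - w) 0 + max (\<bar>w - v\<bar> - c) 0)"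
    (is "?L \<le> max ?stay ?turn")
proof -
  consider (above) "l + c < w" | (below) "w < h" | (within) "h \<le> w" "w \<le> l + c" by linarith
  then have "?L \<le> ?stay \<or> ?L \<le> ?turn"
  proof cases
    case above
    then have eqs: "min w (max l (w - c)) = w - c" "max (w - c) (min h w) = w - c"
      using assms by auto
    show ?thesis
      unfolding eqs by (cases "v \<le> w"; use assms above in \<open>simp add: max_def abs_if\<close>)
  next
    case below
    then have eqs: "min w (max l (w - c)) = w" "max (w - c) (min h w) = w"
      using assms by auto
    show ?thesis
      unfolding eqs by (cases "w \<le> v"; use assms below in \<open>simp add: max_def abs_if\<close>)
  next
    case within
    then have eqs: "min w (max l (w - c)) = min w l" "max (w - c) (min h w) = max (w - c) h"
      "max (w - c - l) 0 = 0" "max (h - w) 0 = 0"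
      using assms by auto
    consider "v \<le> min w l + c" "max (w - c) h \<le> v" | "min w l + c < v" "max (w - c) h \<le> v"
      | "v < max (w - c) h" "v \<le> min w l + c"
      using assms within by linarith
    then show ?thesis
    proof cases
      case 1
      then have "?L = N" unfolding eqs by simp
      also have "N \<le> ?stay" by simp
      finally show ?thesis ..
    next
      case 2
      then have "?L = N + (v - c - min w l)" unfolding eqs by auto
      then show ?thesis unfolding eqs using assms within 2 by (cases "w \<le> l") auto
    next
      case 3
      then have "?L = N + (max (w - c) h - v)" unfolding eqs by auto
      then show ?thesis unfolding eqs using assms within 3 by (cases "w - c \<le> h") auto
    qed
  qed
  then show ?thesis by (simp only: le_max_iff_disj)
qed

text \<open>
  This is the combinatorial core: the integral of the crossing numbers of a finite list is at most
  the truncated variation along one of its sublists.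

  The induction prepends elements and needs to know which levels gain a crossing. For almost
  every level \<open>y\<close>, the list first drops below \<open>y\<close> before exceeding \<open>y + c\<close> precisely if \<open>y > l\<close>, and it
  first exceeds \<open>y + c\<close> precisely if \<open>y < h\<close>; neither happens in between. So the state of all levels is
  described by two thresholds, and prepending a value \<open>v\<close> increases the integral by
  \<open>max (v - c - l) 0 + max (h - v) 0\<close>. The last conjunct says that for each \<open>v\<close> this increased integral
  is bounded by the variation along a sublist preceded by \<open>v\<close>. It is what the induction carries;
  the conjunct before it, the bound that is wanted, follows from the last one for the tail of the
  list. The values of \<open>f\<close> and \<open>f - c\<close> are excluded because they may be thresholds, where the strict
  comparison can go wrong; they form a finite set.
\<close>
lemma crossing_integral_attained:
  fixes f :: "'a :: linorder \<Rightarrow> real"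
  assumes c: "c > 0" and "ts \<noteq> []" "sorted_wrt (<) ts"
  shows "\<exists>h l N. h \<le> l \<and> l \<le> h + c \<and> 0 \<le> N \<and>
    (\<forall>y. y \<notin> f ` set ts \<union> (\<lambda>t. f t - c) ` set ts \<longrightarrow>
      (alternation_count (\<lambda>t. f t < y) (\<lambda>t. f t > y + c) ts
         > alternation_count (\<lambda>t. f t > y + c) (\<lambda>t. f t < y) ts \<longleftrightarrow> l < y) \<and>
      (alternation_count (\<lambda>t. f t > y + c) (\<lambda>t. f t < y) ts
         > alternation_count (\<lambda>t. f t < y) (\<lambda>t. f t > y + c) ts \<longleftrightarrow> y < h)) \<and>
    (\<integral>\<^sup>+ y. ennreal (real (alternation_count (\<lambda>t. f t < y) (\<lambda>t. f t > y + c) ts div 2))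
        + ennreal (real (alternation_count (\<lambda>t. f t > y + c) (\<lambda>t. f t < y) ts div 2)) \<partial>lborel) = ennreal N \<and>
    (\<exists>ys. set ys \<subseteq> set ts \<and> sorted_wrt (<) ys \<and> N \<le> step_sum (\<lambda>s t. max (\<bar>f t - f s\<bar> - c) 0) ys) \<and>
    (\<forall>v. \<exists>ys. ys \<noteq> [] \<and> set ys \<subseteq> set ts \<and> sorted_wrt (<) ys \<and>
      N + max (v - c - l) 0 + max (h - v) 0
        \<le> max (\<bar>f (hd ys) - v\<bar> - c) 0 + step_sum (\<lambda>s t. max (\<bar>f t - f s\<bar> - c) 0) ys)"
  using assms(2,3)
proof (induction ts rule: list_nonempty_induct)
  case (single w)
  show ?case
  proof (rule exI[of _ "f w - c"], rule exI[of _ "f w"], rule exI[of _ 0], intro conjI allI impI)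
    show "(\<integral>\<^sup>+ y. ennreal (real (alternation_count (\<lambda>t. f t < y) (\<lambda>t. f t > y + c) [w] div 2))
        + ennreal (real (alternation_count (\<lambda>t. f t > y + c) (\<lambda>t. f t < y) [w] div 2)) \<partial>lborel) = ennreal 0"
      by simp
    show "\<exists>ys. ys \<noteq> [] \<and> set ys \<subseteq> set [w] \<and> sorted_wrt (<) ys \<and>
      0 + max (v - c - f w) 0 + max (f w - c - v) 0
        \<le> max (\<bar>f (hd ys) - v\<bar> - c) 0 + step_sum (\<lambda>s t. max (\<bar>f t - f s\<bar> - c) 0) ys" for v
      using c by (intro exI[of _ "[w]"]) auto
  qed (use c in \<open>auto intro!: exI[of _ "[]"]\<close>)
next
  case (cons w ts)
  let ?A = "\<lambda>ts y. alternation_count (\<lambda>t. f t < y) (\<lambda>t. f t > y + c) ts"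
  let ?B = "\<lambda>ts y. alternation_count (\<lambda>t. f t > y + c) (\<lambda>t. f t < y) ts"
  let ?n = "\<lambda>ts y. ennreal (real (?A ts y div 2)) + ennreal (real (?B ts y div 2))"
  let ?V = "step_sum (\<lambda>s t. max (\<bar>f t - f s\<bar> - c) 0)"
  have w_less: "w < t" if "t \<in> set ts" for t using cons.prems that by auto
  obtain h l N where hl: "h \<le> l" "l \<le> h + c" "0 \<le> N"
    and st: "\<And>y. y \<notin> f ` set ts \<union> (\<lambda>t. f t - c) ` set ts \<Longrightarrow> (?A ts y > ?B ts y \<longleftrightarrow> l < y)
      \<and> (?B ts y > ?A ts y \<longleftrightarrow> y < h)"
    and int: "(\<integral>\<^sup>+ y. ?n ts y \<partial>lborel) = ennreal N"
    and opt: "\<And>v. \<exists>ys. ys \<noteq> [] \<and> set ys \<subseteq> set ts \<and> sorted_wrt (<) ys \<and>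
      N + max (v - c - l) 0 + max (h - v) 0 \<le> max (\<bar>f (hd ys) - v\<bar> - c) 0 + ?V ys"
    using cons.IH cons.prems by force
  \<comment> \<open>The thresholds \<open>l\<close> and \<open>h\<close> clamped to the interval from \<open>f w - c\<close> to \<open>f w\<close>.\<close>
  define h' where "h' = max (f w - c) (min h (f w))"
  define l' where "l' = min (f w) (max l (f w - c))"
  define N' where "N' = N + max (f w - c - l) 0 + max (h - f w) 0"
  let ?F = "f ` set (w # ts) \<union> (\<lambda>t. f t - c) ` set (w # ts)"
  have A: "?A (w # ts) y = (if f w < y then Suc (?B ts y) else ?A ts y)"
    and B: "?B (w # ts) y = (if f w > y + c then Suc (?A ts y) else ?B ts y)" for y
    by simp_all
  have swap: "?A ts y = 0 \<and> ?B ts y = 0 \<or> ?A ts y = Suc (?B ts y) \<or> ?B ts y = Suc (?A ts y)" for y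
    by (rule alternation_count_swap) (use c in auto)
  have "(\<integral>\<^sup>+ y. ?n (w # ts) y \<partial>lborel)
     = (\<integral>\<^sup>+ y. ?n ts y + (indicator {f w<..<h} y + indicator {l<..<f w - c} y) \<partial>lborel)"
  proof (rule nn_integral_cong_AE)
    have "finite ?F" by simp
    then have "AE y in lborel. y \<notin> ?F"
      by (intro AE_not_in) (simp add: finite_imp_null_set_lborel)
    then show
      "AE y in lborel. ?n (w # ts) y = ?n ts y + (indicator {f w<..<h} y + indicator {l<..<f w - c} y)"
    proof eventually_elim
      case (elim y)
      have "?A (w # ts) y div 2 + ?B (w # ts) y div 2
          = ?A ts y div 2 + ?B ts y div 2 + (of_bool (y \<in> {f w<..<h}) + of_bool (y \<in> {l<..<f w - c}))"
      proof -
        have st': "?A ts y > ?B ts y \<longleftrightarrow> l < y" "?B ts y > ?A ts y \<longleftrightarrow> y < h"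
          using st[of y] elim by auto
        consider "f w < y" "\<not> f w > y + c" | "\<not> f w < y" "f w > y + c" | "\<not> f w < y" "\<not> f w > y + c"
          using c by linarith
        then show ?thesis
        proof cases
          case 1
          then have "\<not> (l < y \<and> y < f w - c)" "f w < y \<and> y < h \<longleftrightarrow> ?B ts y > ?A ts y"
            using st' by (simp_all only: simp_thms) linarith
          then show ?thesis
            unfolding A B greaterThanLessThan_iff using 1 swap[of y]
              by (simp del: alternation_count.simps) linarith
        next
          case 2
          then have "\<not> (f w < y \<and> y < h)" "l < y \<and> y < f w - c \<longleftrightarrow> ?A ts y > ?B ts y"
            using st' by (simp_all only: simp_thms) linarith
          then show ?thesis
            unfolding A B greaterThanLessThan_iff using 2 swap[of y]
              by (simp del: alternation_count.simps) linarith
        next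
          case 3
          then have "\<not> (f w < y \<and> y < h)" "\<not> (l < y \<and> y < f w - c)"
            by linarith+
          then show ?thesis
            unfolding A B greaterThanLessThan_iff using 3 by (simp del: alternation_count.simps)
        qed
      qed
      moreover have "ennreal (real m) + ennreal (real n) = ennreal (real (m + n))" for m n
        by (simp add: ennreal_plus)
      moreover have "(indicator S y :: ennreal) = ennreal (real (of_bool (y \<in> S)))" for S
        by (simp add: indicator_def)
      ultimately show ?case by (simp only:)
    qed
  qed
  also have
    "\<dots> = (\<integral>\<^sup>+ y. ?n ts y \<partial>lborel) + (emeasure lborel {f w<..<h} + emeasure lborel {l<..<f w - c})"
  proof -
    have meas: "?n ts \<in> borel_measurable lborel"
      by (intro borel_measurable_add measurable_up_count measurable_down_count)
    have ind: "(indicator {p<..<q} :: real \<Rightarrow> ennreal) \<in> borel_measurable lborel" for p q :: real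
      by simp
    show ?thesis
      by (simp only: nn_integral_add[OF meas borel_measurable_add[OF ind ind]] nn_integral_add[OF ind ind]
        nn_integral_indicator sets_lborel borel_open open_greaterThanLessThan)
  qed
  also have "\<dots> = ennreal N'"
    unfolding int emeasure_lborel_Ioo_max N'_def using hl by (simp add: ennreal_plus algebra_simps)
  finally have int': "(\<integral>\<^sup>+ y. ?n (w # ts) y \<partial>lborel) = ennreal N'" .
  \<comment> \<open>Stepping on to \<open>w\<close> from a new value \<open>v\<close> is followed by the sublist that is optimal after \<open>f w\<close>.\<close>
  obtain ws where ws: "ws \<noteq> []" "set ws \<subseteq> set ts" "sorted_wrt (<) ws"
     "N' \<le> max (\<bar>f (hd ws) - f w\<bar> - c) 0 + ?V ws"
    using opt[of "f w"] unfolding N'_def by auto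
  have wws: "set (w # ws) \<subseteq> set (w # ts)" "sorted_wrt (<) (w # ws)" "N' \<le> ?V (w # ws)"
    using ws w_less by (auto simp: neq_Nil_conv)
  show ?case
  proof (rule exI[of _ h'], rule exI[of _ l'], rule exI[of _ N'], intro conjI allI impI)
    show "h' \<le> l'" "l' \<le> h' + c" "0 \<le> N'"
      using hl c by (auto simp: h'_def l'_def N'_def)
    show "(\<integral>\<^sup>+ y. ?n (w # ts) y \<partial>lborel) = ennreal N'" by (rule int')
    show "\<exists>ys. set ys \<subseteq> set (w # ts) \<and> sorted_wrt (<) ys \<and> N' \<le> ?V ys"
      using wws by blast
  next
    fix y assume "y \<notin> ?F"
    then have st': "?A ts y > ?B ts y \<longleftrightarrow> l < y" "?B ts y > ?A ts y \<longleftrightarrow> y < h"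
      and ne: "y \<noteq> f w" "y \<noteq> f w - c"
      using st[of y] by auto
    consider "f w < y" "\<not> f w > y + c" | "\<not> f w < y" "f w > y + c" | "\<not> f w < y" "\<not> f w > y + c"
      using c by linarith
    then have "(?A (w # ts) y > ?B (w # ts) y \<longleftrightarrow> l' < y) \<and> (?B (w # ts) y > ?A (w # ts) y \<longleftrightarrow> y < h')"
    proof cases
      case 1
      then have "l' < y" "\<not> y < h'" using c by (auto simp: l'_def h'_def)
      then show ?thesis unfolding A B using 1 by simp
    next
      case 2
      then have "\<not> l' < y" "y < h'" using c by (auto simp: l'_def h'_def)
      then show ?thesis unfolding A B using 2 by simp
    next
      case 3
      then have "l' < y \<longleftrightarrow> l < y" "y < h' \<longleftrightarrow> y < h" using ne c by (auto simp: l'_def h'_def)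
      then show ?thesis unfolding A B using 3 st' by simp
    qed
    then show "?A (w # ts) y > ?B (w # ts) y \<longleftrightarrow> l' < y" "?B (w # ts) y > ?A (w # ts) y \<longleftrightarrow> y < h'"
      by simp_all
  next
    fix v
    obtain vs where vs: "vs \<noteq> []" "set vs \<subseteq> set ts" "sorted_wrt (<) vs"
      "N + max (v - c - l) 0 + max (h - v) 0 \<le> max (\<bar>f (hd vs) - v\<bar> - c) 0 + ?V vs"
      using opt[of v] by auto
    have "N' + max (v - c - l') 0 + max (h' - v) 0
       \<le> max (N + max (v - c - l) 0 + max (h - v) 0) (N' + max (\<bar>f w - v\<bar> - c) 0)"
      using clamp_inequality[OF hl(1,2) c] unfolding N'_def l'_def h'_def .
    then consider "N' + max (v - c - l') 0 + max (h' - v) 0 \<le> max (\<bar>f (hd vs) - v\<bar> - c) 0 + ?V vs"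
      | "N' + max (v - c - l') 0 + max (h' - v) 0 \<le> ?V (w # ws) + max (\<bar>f w - v\<bar> - c) 0"
      using vs(4) wws(3) by linarith
    then show "\<exists>ys. ys \<noteq> [] \<and> set ys \<subseteq> set (w # ts) \<and> sorted_wrt (<) ys \<and>
      N' + max (v - c - l') 0 + max (h' - v) 0 \<le> max (\<bar>f (hd ys) - v\<bar> - c) 0 + ?V ys"
    proof cases
      case 1
      then show ?thesis using vs by (intro exI[of _ vs]) auto
    next
      case 2
      then show ?thesis using wws(1,2) by (intro exI[of _ "w # ws"]) auto
    qed
  qed
qed

section \<open>Counts as step functions of the level\<close>

text \<open>
  The pieces are the classes of numbers that have the same position relative to each breakpoint:
  the breakpoints themselves and the open intervals between them.
\<close>
lemma step_function_on_UNIV_if_finite_breakpoints: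
  fixes g :: "real \<Rightarrow> real"
  assumes "finite F"
    and g: "\<And>y z. (\<And>p. p \<in> F \<Longrightarrow> (p < y \<longleftrightarrow> p < z) \<and> (y < p \<longleftrightarrow> z < p)) \<Longrightarrow> g y = g z"
  shows "step_function_on UNIV g"
proof -
  define cell where "cell y = {z. \<forall>p\<in>F. (p < y \<longleftrightarrow> p < z) \<and> (y < p \<longleftrightarrow> z < p)}" for y
  have self: "y \<in> cell y" for y by (simp add: cell_def)
  have eq: "cell y = cell z" if "x \<in> cell y" "x \<in> cell z" for x y z
    using that unfolding cell_def by blast
  have "finite (range cell)"
  proof (rule finite_subset)
    show "range cell \<subseteq> (\<lambda>(A, B). {z. {p\<in>F. p < z} = A \<and> {p\<in>F. z < p} = B}) ` (Pow F \<times> Pow F)"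
    proof
      fix C assume "C \<in> range cell"
      then obtain y where "C = cell y" by blast
      also have "cell y = {z. {p\<in>F. p < z} = {p\<in>F. p < y} \<and> {p\<in>F. z < p} = {p\<in>F. y < p}}"
        unfolding cell_def by blast
      finally show "C \<in> (\<lambda>(A, B). {z. {p\<in>F. p < z} = A \<and> {p\<in>F. z < p} = B}) ` (Pow F \<times> Pow F)"
        by (intro image_eqI[of _ _ "({p\<in>F. p < y}, {p\<in>F. y < p})"]) auto
    qed
  qed (use \<open>finite F\<close> in simp)
  moreover have "partition_on UNIV (range cell)"
    unfolding partition_on_def
  proof (intro conjI)
    show "\<Union> (range cell) = UNIV" using self by blast
    show "{} \<notin> range cell" using self by blast
    show "disjoint (range cell)" unfolding disjoint_def using eq by blast
  qed
  moreover have "(\<exists>x. cell y = {x}) \<or> (open (cell y) \<and> is_interval (cell y))" for y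
  proof (cases "y \<in> F")
    case True
    then have "z = y" if "z \<in> cell y" for z
      using that by (force simp: cell_def dest!: bspec[of _ _ y])
    then have "cell y = {y}" using self by blast
    then show ?thesis by blast
  next
    case False
    have "cell y = (\<Inter>p\<in>F. if p < y then {p<..} else {..<p})"
    proof -
      have "z \<in> cell y \<longleftrightarrow> (\<forall>p\<in>F. z \<in> (if p < y then {p<..} else {..<p}))" for z
        unfolding cell_def mem_Collect_eq
      proof (intro ball_cong refl)
        fix p assume "p \<in> F"
        then have "p \<noteq> y" using False by blast
        then show "(p < y \<longleftrightarrow> p < z) \<and> (y < p \<longleftrightarrow> z < p) \<longleftrightarrow> z \<in> (if p < y then {p<..} else {..<p})"
          by (cases "p < y") auto
      qed
      then show ?thesis by blast
    qed
    also have "open \<dots>" using \<open>finite F\<close> by (intro open_INT) auto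
    finally have "open (cell y)" .
    moreover have "is_interval (cell y)"
      unfolding is_interval_1
    proof (intro ballI allI impI)
      fix u v x assume "u \<in> cell y" "v \<in> cell y" "u \<le> x \<and> x \<le> v"
      then have "(p < y \<longleftrightarrow> p < x) \<and> (y < p \<longleftrightarrow> x < p)" if "p \<in> F" for p
        using that unfolding cell_def mem_Collect_eq by (smt (verit))
      then show "x \<in> cell y" by (simp add: cell_def)
    qed
    ultimately show ?thesis by blast
  qed
  moreover have "g constant_on (cell y)" for y
    unfolding constant_on_def by (rule exI[of _ "g y"], intro ballI g) (auto simp: cell_def)
  ultimately show ?thesis
    unfolding step_function_on_def by (intro exI[of _ "range cell"]) blast
qed

lemma step_function_counts:
  "step_function_on UNIV (\<lambda>y. real (up_count c f ts y))"
  "step_function_on UNIV (\<lambda>y. real (down_count c f ts y))"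
proof -
  let ?F = "f ` set ts \<union> (\<lambda>t. f t - c) ` set ts"
  have same: "(f t < y \<longleftrightarrow> f t < z) \<and> (f t > y + c \<longleftrightarrow> f t > z + c)"
    if "t \<in> set ts" and same: "\<And>p. p \<in> ?F \<Longrightarrow> (p < y \<longleftrightarrow> p < z) \<and> (y < p \<longleftrightarrow> z < p)" for t y z
    using same[of "f t"] same[of "f t - c"] that(1) by (auto simp: algebra_simps)
  show "step_function_on UNIV (\<lambda>y. real (up_count c f ts y))"
  proof (rule step_function_on_UNIV_if_finite_breakpoints[of ?F])
    fix y z assume *: "\<And>p. p \<in> ?F \<Longrightarrow> (p < y \<longleftrightarrow> p < z) \<and> (y < p \<longleftrightarrow> z < p)"
    have "(f t < y \<longleftrightarrow> f t < z) \<and> (f t > y + c \<longleftrightarrow> f t > z + c)" if "t \<in> set ts" for t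
      by (rule same[OF that *])
    then show "real (up_count c f ts y) = real (up_count c f ts z)"
      by (subst alternation_count_cong[of ts _ "\<lambda>t. f t < z" _ "\<lambda>t. f t > z + c"]) blast+
  qed simp
  show "step_function_on UNIV (\<lambda>y. real (down_count c f ts y))"
  proof (rule step_function_on_UNIV_if_finite_breakpoints[of ?F])
    fix y z assume *: "\<And>p. p \<in> ?F \<Longrightarrow> (p < y \<longleftrightarrow> p < z) \<and> (y < p \<longleftrightarrow> z < p)"
    have "(f t < y \<longleftrightarrow> f t < z) \<and> (f t > y + c \<longleftrightarrow> f t > z + c)" if "t \<in> set ts" for t
      by (rule same[OF that *])
    then show "real (down_count c f ts y) = real (down_count c f ts z)"
      by (subst alternation_count_cong[of ts _ "\<lambda>t. f t > z + c" _ "\<lambda>t. f t < z"]) blast+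
  qed simp
qed

section \<open>Truncated variations and crossing numbers as limits\<close>

text \<open>
  Subdivisions as lists. The empty list, which comes from no subdivision, has \<open>step_sum\<close> zero and
  therefore does not change the supremum of the nonnegative sums.
\<close>
definition increasing_lists :: "real set \<Rightarrow> real list set" where
  "increasing_lists S = {ts. sorted_wrt (<) ts \<and> set ts \<subseteq> S}"

lemma step_sum_eq_sum: "step_sum g ts = (\<Sum>i=1..length ts - 1. g (ts ! (i - 1)) (ts ! i))"
proof -
  have "step_sum g ts = (\<Sum>i<length ts - 1. g (ts ! i) (ts ! Suc i))"
  proof (induction g ts rule: step_sum.induct)
    case (3 g s t ts)
    then show ?case by (simp add: sum.lessThan_Suc_shift del: sum.lessThan_Suc)
  qed auto
  then show ?thesis by (simp add: sum.atLeast1_atMost_eq)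
qed

lemma SUP_subdivisions_eq:
  assumes "a \<le> b"
  shows "(SUP (n, t)\<in>subdivisions a b. ennreal (\<Sum>i=1..n. g (t (i - 1)) (t i)))
    = (SUP ts\<in>increasing_lists {a..b}. ennreal (step_sum g ts))"
proof (rule antisym)
  show "(SUP (n, t)\<in>subdivisions a b. ennreal (\<Sum>i=1..n. g (t (i - 1)) (t i)))
    \<le> (SUP ts\<in>increasing_lists {a..b}. ennreal (step_sum g ts))"
  proof (rule SUP_least)
    fix nt assume "nt \<in> subdivisions a b"
    then obtain n t where nt: "nt = (n, t)" and t: "a \<le> t 0" "\<And>i. i < n \<Longrightarrow> t i < t (Suc i)" "t n \<le> b"
      by (auto simp: subdivisions_def)
    have less: "t i < t j" if "i < j" "j \<le> n" for i j
      using that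
    proof (induction j)
      case (Suc j)
      then show ?case using t(2)[of j] by (cases "i = j") auto
    qed simp
    let ?ts = "map t [0..<Suc n]"
    have "sorted_wrt (<) ?ts"
      unfolding sorted_wrt_iff_nth_less using less by (auto simp del: upt_Suc)
    moreover have "t i \<in> {a..b}" if "i \<le> n" for i
      using less[of 0 i] less[of i n] t that by (cases "i = 0"; cases "i = n") auto
    ultimately have "?ts \<in> increasing_lists {a..b}"
      by (auto simp: increasing_lists_def simp del: upt_Suc)
    moreover have "step_sum g ?ts = (\<Sum>i=1..n. g (t (i - 1)) (t i))"
      unfolding step_sum_eq_sum by (rule sum.cong) (auto simp del: upt_Suc)
    ultimately show "(case nt of (n, t) \<Rightarrow> ennreal (\<Sum>i=1..n. g (t (i - 1)) (t i)))
      \<le> (SUP ts\<in>increasing_lists {a..b}. ennreal (step_sum g ts))"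
      unfolding nt by (auto intro: SUP_upper2)
  qed
  show "(SUP ts\<in>increasing_lists {a..b}. ennreal (step_sum g ts))
    \<le> (SUP (n, t)\<in>subdivisions a b. ennreal (\<Sum>i=1..n. g (t (i - 1)) (t i)))"
  proof (rule SUP_least)
    fix ts assume ts: "ts \<in> increasing_lists {a..b}"
    show "ennreal (step_sum g ts)
      \<le> (SUP (n, t)\<in>subdivisions a b. ennreal (\<Sum>i=1..n. g (t (i - 1)) (t i)))"
    proof (cases "ts = []")
      case False
      have "ts ! i \<in> {a..b}" if "i < length ts" for i
        using ts that nth_mem[of i ts] unfolding increasing_lists_def by blast
      then have "(length ts - 1, (!) ts) \<in> subdivisions a b"
        using ts False sorted_wrt_nth_less[of "(<)" ts]
        by (auto simp: subdivisions_def increasing_lists_def)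
      then show ?thesis
        unfolding step_sum_eq_sum by (rule SUP_upper2) simp
    qed simp
  qed
qed

lemma le_count_iff:
  assumes "sorted_wrt (<) ts"
  shows "n \<le> up_count c f ts y
      \<longleftrightarrow> alternation (2 * n) (set ts) (\<lambda>t. f t < y) (\<lambda>t. f t > y + c) (-\<infinity>)"
    and "n \<le> down_count c f ts y
      \<longleftrightarrow> alternation (2 * n) (set ts) (\<lambda>t. f t > y + c) (\<lambda>t. f t < y) (-\<infinity>)"
proof -
  have "n \<le> m div 2 \<longleftrightarrow> 2 * n \<le> m" for m :: nat by linarith
  then show "n \<le> up_count c f ts y
      \<longleftrightarrow> alternation (2 * n) (set ts) (\<lambda>t. f t < y) (\<lambda>t. f t > y + c) (-\<infinity>)"
    "n \<le> down_count c f ts y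
      \<longleftrightarrow> alternation (2 * n) (set ts) (\<lambda>t. f t > y + c) (\<lambda>t. f t < y) (-\<infinity>)"
    using le_alternation_count_iff[OF assms, of "-\<infinity>"] by simp_all
qed

lemma count_mono:
  fixes ss ts :: "real list"
  assumes "sorted_wrt (<) ss" "sorted_wrt (<) ts" "set ss \<subseteq> set ts"
  shows "up_count c f ss y \<le> up_count c f ts y" "down_count c f ss y \<le> down_count c f ts y"
  unfolding le_count_iff[OF assms(2)]
  by (rule alternation_mono[OF le_count_iff(1)[OF assms(1), THEN iffD1] assms(3)],
      simp, rule alternation_mono[OF le_count_iff(2)[OF assms(1), THEN iffD1] assms(3)], simp)

lemma count_le_crossings:
  assumes "regulated_on a b f" "a \<le> b" "c > 0" "ts \<in> increasing_lists {a..b}"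
  shows "up_count c f ts y \<le> upcrossings c f a b y" "down_count c f ts y \<le> downcrossings c f a b y"
proof -
  have ts: "sorted_wrt (<) ts" "set ts \<subseteq> {a..b}" using assms(4) by (auto simp: increasing_lists_def)
  show "up_count c f ts y \<le> upcrossings c f a b y"
    unfolding le_upcrossings_iff[OF assms(1-3)]
    by (rule alternation_mono[OF le_count_iff(1)[OF ts(1), THEN iffD1] ts(2)]) simp
  show "down_count c f ts y \<le> downcrossings c f a b y"
    unfolding le_downcrossings_iff[OF assms(1-3)]
    by (rule alternation_mono[OF le_count_iff(2)[OF ts(1), THEN iffD1] ts(2)]) simp
qed

text \<open>
  For a fixed level the crossing number is realised by one finite alternation, which moves into
  some set of an exhausting sequence; from then on the count along that set is the
  crossing number.
\<close>
lemma finite_counts_exhaust_crossings: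
  fixes f :: "real \<Rightarrow> real"
  assumes reg: "regulated_on a b f" "a \<le> b" "c > 0"
  obtains L :: "nat \<Rightarrow> real list"
  where "\<And>k. L k \<in> increasing_lists {a..b}"
    and "\<And>y. incseq (\<lambda>k. up_count c f (L k) y)" "\<And>y. incseq (\<lambda>k. down_count c f (L k) y)"
    and "\<And>y. eventually (\<lambda>k. up_count c f (L k) y = upcrossings c f a b y) sequentially"
    and "\<And>y. eventually (\<lambda>k. down_count c f (L k) y = downcrossings c f a b y) sequentially"
proof -
  obtain T :: "nat \<Rightarrow> real set" where T: "incseq T" "\<And>k. finite (T k)" "\<And>k. T k \<subseteq> {a..b}"
    and dense: "\<And>t e. t \<in> {a..b} \<Longrightarrow> e > 0 \<Longrightarrow> \<exists>k. \<exists>d\<in>T k. \<bar>d - t\<bar> < e \<and> \<bar>f d - f t\<bar> < e"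
    using finite_graph_exhaustion[of "{a..b}" f] \<open>a \<le> b\<close> by (auto simp del: atLeastAtMost_iff)
  define L where "L k = sorted_list_of_set (T k)" for k
  have L: "sorted_wrt (<) (L k)" "set (L k) = T k" for k
    using T(2) by (simp_all add: L_def)
  have mono: "set (L j) \<subseteq> set (L k)" if "j \<le> k" for j k
    unfolding L using T(1) that by (simp add: incseq_def)
  show thesis
  proof
    show in_lists: "L k \<in> increasing_lists {a..b}" for k
      using L T(3) by (simp add: increasing_lists_def)
    show inc: "incseq (\<lambda>k. up_count c f (L k) y)" "incseq (\<lambda>k. down_count c f (L k) y)" for y
      unfolding incseq_def using count_mono[OF L(1) L(1) mono] by blast+
    fix y
    have lim: "eventually (\<lambda>k. u k = m) sequentially"
      if "incseq u" "\<And>k. u k \<le> m" "m \<le> u k" for u :: "nat \<Rightarrow> nat" and m k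
      using eventually_ge_at_top[of k]
    proof eventually_elim
      case (elim j)
      then show ?case using that(1)[unfolded incseq_def, rule_format, of k j] that(2)[of j] that(3)
        by linarith
    qed
    have ex: "\<exists>k. alternation n (T k) (\<lambda>t. f t \<in> U) (\<lambda>t. f t \<in> V) (-\<infinity>)"
      if UV: "open U" "open V" and alt: "alternation n {a..b} (\<lambda>t. f t \<in> U) (\<lambda>t. f t \<in> V) (-\<infinity>)" for n U V
    proof -
      obtain k s where "-\<infinity> < s" "alternation n (T k) (\<lambda>t. f t \<in> U) (\<lambda>t. f t \<in> V) s"
        using alternation_exhaustion[OF T(1) dense UV alt] by auto
      then show ?thesis using alternation_antimono[of n "T k" _ _ s "-\<infinity>"] by auto
    qed
    have "alternation (2 * upcrossings c f a b y) {a..b} (\<lambda>t. f t \<in> {..<y}) (\<lambda>t. f t \<in> {y + c<..}) (-\<infinity>)"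
      using le_upcrossings_iff[OF reg, of "upcrossings c f a b y" y] by simp
    from ex[OF open_lessThan open_greaterThan this] obtain k where
      "upcrossings c f a b y \<le> up_count c f (L k) y"
      unfolding le_count_iff[OF L(1)] L(2) by auto
    then show "eventually (\<lambda>k. up_count c f (L k) y = upcrossings c f a b y) sequentially"
      by (intro lim[of _ _ k] inc count_le_crossings[OF reg in_lists])
    have "alternation (2 * downcrossings c f a b y) {a..b} (\<lambda>t. f t \<in> {y + c<..}) (\<lambda>t. f t \<in> {..<y}) (-\<infinity>)"
      using le_downcrossings_iff[OF reg, of "downcrossings c f a b y" y] by simp
    from ex[OF open_greaterThan open_lessThan this] obtain k where
      "downcrossings c f a b y \<le> down_count c f (L k) y"
      unfolding le_count_iff[OF L(1)] L(2) by auto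
    then show "eventually (\<lambda>k. down_count c f (L k) y = downcrossings c f a b y) sequentially"
      by (intro lim[of _ _ k] inc count_le_crossings[OF reg in_lists])
  qed
qed

text \<open>
  Finiteness of the bounds permits the cancellation that forces equality in both summands.
\<close>
lemma ennreal_add_eq_parts:
  fixes x y :: ennreal
  assumes "ennreal p \<le> x" "ennreal q \<le> y" "x + y \<le> ennreal p + ennreal q"
  shows "x = ennreal p" "y = ennreal q"
proof -
  have "ennreal q + x \<le> ennreal q + ennreal p"
    using add_mono[OF order.refl assms(2), of x] assms(3) by (metis add.commute order.trans)
  then have "x \<le> ennreal p"
    unfolding ennreal_add_left_cancel_le by simp
  with assms(1) show "x = ennreal p" by (metis antisym)
  have "ennreal p + y \<le> ennreal p + ennreal q"
    using add_mono[OF assms(1) order.refl, of y] assms(3) by (rule order.trans)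
  then have "y \<le> ennreal q"
    unfolding ennreal_add_left_cancel_le by simp
  with assms(2) show "y = ennreal q" by (metis antisym)
qed

section \<open>Integral formulas\<close>

theorem theorem1:
  fixes a b c :: real and f :: "real \<Rightarrow> real"
  assumes "a < b" and "regulated_on a b f" and "c > 0"
  shows "pointwise_limit_of_step_functions (\<lambda>y. real (upcrossings c f a b y))
    \<and> pointwise_limit_of_step_functions (\<lambda>y. real (downcrossings c f a b y))
    \<and> UTV c f a b = (\<integral>\<^sup>+ y. ennreal (real (upcrossings c f a b y)) \<partial>lborel)
    \<and> DTV c f a b = (\<integral>\<^sup>+ y. ennreal (real (downcrossings c f a b y)) \<partial>lborel)
    \<and> TV c f a b = (\<integral>\<^sup>+ y. ennreal (real (crossings c f a b y)) \<partial>lborel)"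
proof -
  have "a \<le> b" using \<open>a < b\<close> by simp
  note reg = \<open>regulated_on a b f\<close> \<open>a \<le> b\<close> \<open>c > 0\<close>
  let ?up = "\<lambda>s t. max (f t - f s - c) 0" and ?down = "\<lambda>s t. max (f s - f t - c) 0"
    and ?abs = "\<lambda>s t. max (\<bar>f t - f s\<bar> - c) 0"
  let ?X = "increasing_lists {a..b}"
  let ?U = "\<lambda>ts y. ennreal (real (up_count c f ts y))" and ?D =
    "\<lambda>ts y. ennreal (real (down_count c f ts y))"
  let ?u = "\<lambda>y. ennreal (real (upcrossings c f a b y))" and ?d =
    "\<lambda>y. ennreal (real (downcrossings c f a b y))"
  obtain L where L: "\<And>k. L k \<in> ?X"
    and inc: "\<And>y. incseq (\<lambda>k. up_count c f (L k) y)" "\<And>y. incseq (\<lambda>k. down_count c f (L k) y)"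
    and ev: "\<And>y. eventually (\<lambda>k. up_count c f (L k) y = upcrossings c f a b y) sequentially"
      "\<And>y. eventually (\<lambda>k. down_count c f (L k) y = downcrossings c f a b y) sequentially"
    using finite_counts_exhaust_crossings[OF reg] by blast
  have split:
    "(\<integral>\<^sup>+ y. ?U ts y + ?D ts y \<partial>lborel) = (\<integral>\<^sup>+ y. ?U ts y \<partial>lborel) + (\<integral>\<^sup>+ y. ?D ts y \<partial>lborel)" for ts
    by (rule nn_integral_add) (rule measurable_up_count measurable_down_count)+

  have variations: "UTV c f a b = (SUP ts\<in>?X. ennreal (step_sum ?up ts))"
    "DTV c f a b = (SUP ts\<in>?X. ennreal (step_sum ?down ts))"
    "TV c f a b = (SUP ts\<in>?X. ennreal (step_sum ?abs ts))"
    unfolding UTV_def DTV_def TV_def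
    by (rule SUP_subdivisions_eq[OF \<open>a \<le> b\<close>])+
  have "?abs = (\<lambda>s t. ?up s t + ?down s t)"
    using \<open>c > 0\<close> by (intro ext) (auto simp: max_def abs_if)
  then have abs_split: "step_sum ?abs ts = step_sum ?up ts + step_sum ?down ts" for ts
    by (simp only: step_sum_add)
  have abs_split':
    "ennreal (step_sum ?abs ts) = ennreal (step_sum ?up ts) + ennreal (step_sum ?down ts)" for ts
    unfolding abs_split by (intro ennreal_plus step_sum_nonneg) simp_all

  have upper: "UTV c f a b \<le> (\<integral>\<^sup>+ y. ?u y \<partial>lborel)" "DTV c f a b \<le> (\<integral>\<^sup>+ y. ?d y \<partial>lborel)"
    "TV c f a b \<le> (\<integral>\<^sup>+ y. ?u y + ?d y \<partial>lborel)"
    unfolding variations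
  proof (safe intro!: SUP_least)
    fix ts assume ts: "ts \<in> ?X"
    note up = step_sum_le_integral_up[OF \<open>c > 0\<close>, of f ts]
      and down = step_sum_le_integral_down[OF \<open>c > 0\<close>, of f ts]
    have le: "?U ts y \<le> ?u y" "?D ts y \<le> ?d y" for y
      using count_le_crossings[OF reg ts] by (simp_all add: ennreal_leI)
    show "ennreal (step_sum ?up ts) \<le> (\<integral>\<^sup>+ y. ?u y \<partial>lborel)"
      using up by (rule order.trans) (intro nn_integral_mono le)
    show "ennreal (step_sum ?down ts) \<le> (\<integral>\<^sup>+ y. ?d y \<partial>lborel)"
      using down by (rule order.trans) (intro nn_integral_mono le)
    have "ennreal (step_sum ?abs ts) \<le> (\<integral>\<^sup>+ y. ?U ts y + ?D ts y \<partial>lborel)"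
      unfolding abs_split' split by (intro add_mono up down)
    then show "ennreal (step_sum ?abs ts) \<le> (\<integral>\<^sup>+ y. ?u y + ?d y \<partial>lborel)"
      by (rule order.trans) (intro nn_integral_mono add_mono le)
  qed

  \<comment> \<open>Along the sublist \<open>ys\<close> that attains the integral of all crossings, the inequalities for up and down
      steps add up to an equality, hence each of them is one. A single \<open>ys\<close> thus serves all three
      variations.\<close>
  have finite_lower: "(\<integral>\<^sup>+ y. ?U (L k) y \<partial>lborel) \<le> UTV c f a b \<and> (\<integral>\<^sup>+ y. ?D (L k) y \<partial>lborel)
    \<le> DTV c f a b
      \<and> (\<integral>\<^sup>+ y. ?U (L k) y + ?D (L k) y \<partial>lborel) \<le> TV c f a b" for k
  proof -
    have sorted: "sorted_wrt (<) (L k)" and sub: "set (L k) \<subseteq> {a..b}"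
      using L[of k] by (auto simp: increasing_lists_def)
    obtain ys where ys: "set ys \<subseteq> set (L k)" "sorted_wrt (<) ys"
      "(\<integral>\<^sup>+ y. ?U (L k) y + ?D (L k) y \<partial>lborel) \<le> ennreal (step_sum ?abs ys)"
    proof (cases "L k = []")
      case True
      then show ?thesis using that[of "[]"] by simp
    next
      case False
      from crossing_integral_attained[OF \<open>c > 0\<close> this sorted, of f] obtain N ys where
        "(\<integral>\<^sup>+ y. ?U (L k) y + ?D (L k) y \<partial>lborel) = ennreal N" "set ys \<subseteq> set (L k)" "sorted_wrt (<) ys"
        "N \<le> step_sum ?abs ys"
        by blast
      then show ?thesis using that[of ys] by (simp add: ennreal_leI)
    qed
    have "(\<integral>\<^sup>+ y. ?U ys y \<partial>lborel) \<le> (\<integral>\<^sup>+ y. ?U (L k) y \<partial>lborel)" "(\<integral>\<^sup>+ y. ?D ys y \<partial>lborel)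
      \<le> (\<integral>\<^sup>+ y. ?D (L k) y \<partial>lborel)"
      using count_mono[OF ys(2) sorted ys(1)] by (auto intro!: nn_integral_mono ennreal_leI)
    then have "ennreal (step_sum ?up ys) \<le> (\<integral>\<^sup>+ y. ?U (L k) y \<partial>lborel)" "ennreal (step_sum ?down ys)
      \<le> (\<integral>\<^sup>+ y. ?D (L k) y \<partial>lborel)"
      using step_sum_le_integral_up[OF \<open>c > 0\<close>, of f ys] step_sum_le_integral_down[OF \<open>c > 0\<close>, of f ys]
      by (blast intro: order.trans)+
    note eqs = ennreal_add_eq_parts[OF this, folded split abs_split', OF ys(3)]
    have "ys \<in> ?X" using ys sub by (auto simp: increasing_lists_def)
    then show ?thesis
      unfolding variations eqs using ys(3) by (blast intro: SUP_upper SUP_upper2)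
  qed

  have ev': "eventually (\<lambda>k. ?U (L k) y = ?u y) sequentially"
    "eventually (\<lambda>k. ?D (L k) y = ?d y) sequentially" for y
    using ev[of y] by (auto elim: eventually_mono)
  \<comment> \<open>Monotone convergence, the counts along \<open>L k\<close> being increasing in \<open>k\<close>.\<close>
  have int_lim: "(\<lambda>k. \<integral>\<^sup>+ y. ?U (L k) y \<partial>lborel) \<longlonglongrightarrow> (\<integral>\<^sup>+ y. ?u y \<partial>lborel)"
    "(\<lambda>k. \<integral>\<^sup>+ y. ?D (L k) y \<partial>lborel) \<longlonglongrightarrow> (\<integral>\<^sup>+ y. ?d y \<partial>lborel)"
    "(\<lambda>k. \<integral>\<^sup>+ y. ?U (L k) y + ?D (L k) y \<partial>lborel) \<longlonglongrightarrow> (\<integral>\<^sup>+ y. ?u y + ?d y \<partial>lborel)"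
  proof -
    have incU: "incseq (\<lambda>k. ?U (L k))" and incD: "incseq (\<lambda>k. ?D (L k))"
      using inc by (auto simp: incseq_def le_fun_def intro!: ennreal_leI)
    then have incUD: "incseq (\<lambda>k y. ?U (L k) y + ?D (L k) y)"
      unfolding incseq_def le_fun_def by (blast intro: add_mono)
    show "(\<lambda>k. \<integral>\<^sup>+ y. ?U (L k) y \<partial>lborel) \<longlonglongrightarrow> (\<integral>\<^sup>+ y. ?u y \<partial>lborel)"
      by (rule nn_integral_LIMSEQ[OF incU measurable_up_count tendsto_eventually[OF ev'(1)]])
    show "(\<lambda>k. \<integral>\<^sup>+ y. ?D (L k) y \<partial>lborel) \<longlonglongrightarrow> (\<integral>\<^sup>+ y. ?d y \<partial>lborel)"
      by (rule nn_integral_LIMSEQ[OF incD measurable_down_count tendsto_eventually[OF ev'(2)]])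
    show "(\<lambda>k. \<integral>\<^sup>+ y. ?U (L k) y + ?D (L k) y \<partial>lborel) \<longlonglongrightarrow> (\<integral>\<^sup>+ y. ?u y + ?d y \<partial>lborel)"
      by (rule nn_integral_LIMSEQ[OF incUD borel_measurable_add[OF measurable_up_count measurable_down_count]])
        (rule tendsto_add[OF tendsto_eventually[OF ev'(1)] tendsto_eventually[OF ev'(2)]])
  qed
  have lower: "(\<integral>\<^sup>+ y. ?u y \<partial>lborel) \<le> UTV c f a b" "(\<integral>\<^sup>+ y. ?d y \<partial>lborel) \<le> DTV c f a b"
    "(\<integral>\<^sup>+ y. ?u y + ?d y \<partial>lborel) \<le> TV c f a b"
    using finite_lower
      by (auto intro: LIMSEQ_le_const2[OF int_lim(1)] LIMSEQ_le_const2[OF int_lim(2)] LIMSEQ_le_const2[OF int_lim(3)])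

  have "pointwise_limit_of_step_functions (\<lambda>y. real (upcrossings c f a b y))"
    unfolding pointwise_limit_of_step_functions_def
  proof (intro exI[of _ "\<lambda>k y. real (up_count c f (L k) y)"] conjI allI step_function_counts)
    show "(\<lambda>k. real (up_count c f (L k) y)) \<longlonglongrightarrow> real (upcrossings c f a b y)" for y
      using ev(1)[of y] by (intro tendsto_eventually) (rule eventually_mono, simp_all)
  qed
  moreover have "pointwise_limit_of_step_functions (\<lambda>y. real (downcrossings c f a b y))"
    unfolding pointwise_limit_of_step_functions_def
  proof (intro exI[of _ "\<lambda>k y. real (down_count c f (L k) y)"] conjI allI step_function_counts)
    show "(\<lambda>k. real (down_count c f (L k) y)) \<longlonglongrightarrow> real (downcrossings c f a b y)" for y
      using ev(2)[of y] by (intro tendsto_eventually) (rule eventually_mono, simp_all)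
  qed
  moreover have "ennreal (real (crossings c f a b y)) = ?u y + ?d y" for y
    by (simp add: crossings_def ennreal_plus add.commute)
  ultimately show ?thesis
    using upper lower by (auto intro: antisym)
qed

end
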